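(* Let $\mathcal K$ be a complex Hilbert space and let $Q$ be a finite, non-negative, countably additive, $\mathcal L(\mathcal K)$-valued measure on (the Borel sets of) $\mathbb R$. For $\lambda\in\mathbb C_+$ let $$m(\lambda)=\int_{\mathbb R}\frac{1}{s-\lambda}\,Q(\mathrm ds).$$ Given $[a,b]\subset\mathbb R$ and $L>0$, let $X,Y$ be bounded self-adjoint operators on $\mathcal K$ such that $$X=\int_{[a,b]}Q(\mathrm ds)=Q([a,b]),\qquad X^{1/2}YX^{1/2}=\int_{[a,b]}s\,Q(\mathrm ds),\qquad aI\le Y\le bI,$$ and let $$\tilde m(\lambda)=\int_{s\notin[a,b]}\frac{1}{s-\lambda}\,Q(\mathrm ds)+X^{1/2}(Y-\lambda I)^{-1}X^{1/2}.$$ Then $$\|m(\lambda)-\tilde m(\lambda)\|\le\frac{2(b-a)^2}{L^3}\,\|Q([a,b])\|$$ for all $\lambda\in\mathbb C_+$ such that $\operatorname{dist}(\lambda,[a,b])\ge L$.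
   Context: $\mathbb C_+=\{z\in\mathbb C:\operatorname{Im}(z)>0\}$; $\mathcal L(\mathcal K)$ is the space of bounded operators on $\mathcal K$ with the operator norm. A finite non-negative countably additive $\mathcal L(\mathcal K)$-valued measure assigns to each Borel set $E\subseteq\mathbb R$ a bounded operator $Q(E)\ge 0$, countably additively in the strong (equivalently weak) operator topology. For a bounded measurable function $f$, the operator $\int f\,\mathrm dQ$ is determined by $\langle(\int f\,\mathrm dQ)\phi,\psi\rangle=\int f(s)\,\langle Q(\mathrm ds)\phi,\psi\rangle$. *)

theory Defs
  imports "HOL-Analysis.Analysis"
begin

text \<open>The inner product is linear in the first argument.\<close>

class complex_hilbert_space = banach +
  fixes scaleC :: "complex \<Rightarrow> 'a \<Rightarrow> 'a"  (infixr "*\<^sub>C" 75)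
    and cinner :: "'a \<Rightarrow> 'a \<Rightarrow> complex"
  assumes scaleC_add_right: "c *\<^sub>C (x + y) = c *\<^sub>C x + c *\<^sub>C y"
    and scaleC_add_left: "(c + d) *\<^sub>C x = c *\<^sub>C x + d *\<^sub>C x"
    and scaleC_scaleC: "c *\<^sub>C (d *\<^sub>C x) = (c * d) *\<^sub>C x"
    and scaleR_scaleC: "r *\<^sub>R x = complex_of_real r *\<^sub>C x"
    and cinner_add_left: "cinner (x + y) z = cinner x z + cinner y z"
    and cinner_scaleC_left: "cinner (c *\<^sub>C x) y = c * cinner x y"
    and cinner_commute: "cinner x y = cnj (cinner y x)"
    and cinner_self: "cinner x x = complex_of_real ((norm x)\<^sup>2)"

lemma norm_scaleC: "norm (c *\<^sub>C x) = cmod c * norm (x :: 'a::complex_hilbert_space)"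
proof -
  have "cinner (c *\<^sub>C x) (c *\<^sub>C x) = c * cnj c * cinner x x"
    by (metis cinner_commute cinner_scaleC_left complex_cnj_mult mult.assoc)
  then have "complex_of_real ((norm (c *\<^sub>C x))\<^sup>2) = complex_of_real ((cmod c * norm x)\<^sup>2)"
    by (simp only: cinner_self complex_norm_square[symmetric] of_real_mult power_mult_distrib
        of_real_power)
  then have "(norm (c *\<^sub>C x))\<^sup>2 = (cmod c * norm x)\<^sup>2"
    by (simp only: of_real_eq_iff)
  then show ?thesis
    by (simp add: power2_eq_iff_nonneg)
qed

text \<open>
  The type of bounded real-linear maps carries the operator norm. The space of bounded operators on
  a complex Hilbert space is its subset of complex-linear maps, with the same norm.
\<close>

definition bounded_ops :: "('a::complex_hilbert_space \<Rightarrow>\<^sub>L 'a) set" where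
  "bounded_ops = {T. \<forall>c x. blinfun_apply T (c *\<^sub>C x) = c *\<^sub>C blinfun_apply T x}"

lift_definition scalar_op :: "complex \<Rightarrow> 'a::complex_hilbert_space \<Rightarrow>\<^sub>L 'a" is "\<lambda>c x. c *\<^sub>C x"
proof -
  fix c :: complex
  show "bounded_linear (\<lambda>x::'a. c *\<^sub>C x)"
    by (rule bounded_linear_intro[where K = "cmod c"])
      (simp_all add: scaleC_add_right scaleR_scaleC scaleC_scaleC norm_scaleC mult.commute)
qed

definition op_selfadjoint :: "('a::complex_hilbert_space \<Rightarrow>\<^sub>L 'a) \<Rightarrow> bool" where
  "op_selfadjoint T \<longleftrightarrow> T \<in> bounded_ops \<and>
    (\<forall>x y. cinner (blinfun_apply T x) y = cinner x (blinfun_apply T y))"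

definition op_nonneg :: "('a::complex_hilbert_space \<Rightarrow>\<^sub>L 'a) \<Rightarrow> bool" where
  "op_nonneg T \<longleftrightarrow> T \<in> bounded_ops \<and> (\<forall>x. cinner (blinfun_apply T x) x \<in> \<real>\<^sub>\<ge>\<^sub>0)"

definition op_le :: "('a::complex_hilbert_space \<Rightarrow>\<^sub>L 'a) \<Rightarrow> ('a \<Rightarrow>\<^sub>L 'a) \<Rightarrow> bool" where
  "op_le S T \<longleftrightarrow> op_nonneg (T - S)"

definition op_sqrt :: "('a::complex_hilbert_space \<Rightarrow>\<^sub>L 'a) \<Rightarrow> ('a \<Rightarrow>\<^sub>L 'a)" where
  "op_sqrt T = (THE S. op_nonneg S \<and> S o\<^sub>L S = T)"

definition op_inverse :: "('a::complex_hilbert_space \<Rightarrow>\<^sub>L 'a) \<Rightarrow> ('a \<Rightarrow>\<^sub>L 'a)" where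
  "op_inverse T = (THE R. R \<in> bounded_ops \<and> R o\<^sub>L T = id_blinfun \<and> T o\<^sub>L R = id_blinfun)"

text \<open>
  Only the values on Borel sets are constrained. Finiteness is built in, because \<open>Q UNIV\<close> is a
  bounded operator. Countable additivity is in the strong operator topology.
\<close>

definition operator_measure :: "(real set \<Rightarrow> 'a::complex_hilbert_space \<Rightarrow>\<^sub>L 'a) \<Rightarrow> bool" where
  "operator_measure Q \<longleftrightarrow>
    (\<forall>E \<in> sets borel. op_nonneg (Q E)) \<and>
    (\<forall>F :: nat \<Rightarrow> real set. range F \<subseteq> sets borel \<longrightarrow> disjoint_family F \<longrightarrow>
      (\<forall>x. (\<lambda>n. blinfun_apply (Q (F n)) x) sums blinfun_apply (Q (\<Union>n. F n)) x))"

text \<open>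
  The integral against a complex Borel measure \<open>\<nu>\<close> is obtained by writing
  \<open>\<nu> = \<mu> 0 + \<i> \<mu> 1 - \<mu> 2 - \<i> \<mu> 3\<close> with finite non-negative measures; its value does not depend on
  the decomposition.
\<close>

definition has_complex_measure_integral ::
    "(real set \<Rightarrow> complex) \<Rightarrow> (real \<Rightarrow> complex) \<Rightarrow> complex \<Rightarrow> bool" where
  "has_complex_measure_integral \<nu> f I \<longleftrightarrow>
    (\<exists>\<mu> :: nat \<Rightarrow> real measure.
      (\<forall>k<4. finite_measure (\<mu> k) \<and> sets (\<mu> k) = sets borel \<and> integrable (\<mu> k) f) \<and>
      (\<forall>E \<in> sets borel. \<nu> E = (\<Sum>k<4. \<i> ^ k * complex_of_real (measure (\<mu> k) E))) \<and>
      I = (\<Sum>k<4. \<i> ^ k * (LINT s|\<mu> k. f s)))"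

definition op_integral ::
    "(real set \<Rightarrow> 'a::complex_hilbert_space \<Rightarrow>\<^sub>L 'a) \<Rightarrow> (real \<Rightarrow> complex) \<Rightarrow> ('a \<Rightarrow>\<^sub>L 'a)" where
  "op_integral Q f = (THE T. T \<in> bounded_ops \<and>
    (\<forall>\<phi> \<psi>. has_complex_measure_integral (\<lambda>E. cinner (blinfun_apply (Q E) \<phi>) \<psi>) f
      (cinner (blinfun_apply T \<phi>) \<psi>)))"

definition op_set_integral ::
    "(real set \<Rightarrow> 'a::complex_hilbert_space \<Rightarrow>\<^sub>L 'a) \<Rightarrow> real set \<Rightarrow> (real \<Rightarrow> complex) \<Rightarrow> ('a \<Rightarrow>\<^sub>L 'a)"
  where "op_set_integral Q A f = op_integral Q (\<lambda>s. indicator A s *\<^sub>R f s)"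

definition m_fun ::
    "(real set \<Rightarrow> 'a::complex_hilbert_space \<Rightarrow>\<^sub>L 'a) \<Rightarrow> complex \<Rightarrow> ('a \<Rightarrow>\<^sub>L 'a)" where
  "m_fun Q z = op_integral Q (\<lambda>s. 1 / (complex_of_real s - z))"

definition m_tilde ::
    "(real set \<Rightarrow> 'a::complex_hilbert_space \<Rightarrow>\<^sub>L 'a) \<Rightarrow> real \<Rightarrow> real \<Rightarrow> ('a \<Rightarrow>\<^sub>L 'a) \<Rightarrow> ('a \<Rightarrow>\<^sub>L 'a) \<Rightarrow>
      complex \<Rightarrow> ('a \<Rightarrow>\<^sub>L 'a)" where
  "m_tilde Q a b X Y z =
    op_set_integral Q (- {a..b}) (\<lambda>s. 1 / (complex_of_real s - z)) +
    (op_sqrt X o\<^sub>L op_inverse (Y - scalar_op z) o\<^sub>L op_sqrt X)"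

end

theory Submission
  imports Defs
begin

text \<open>
  Write \<open>c\<close> for the midpoint of \<open>[a, b]\<close>, \<open>r = (b - a)/2\<close> and \<open>\<alpha> = 1/(c - z)\<close>. The part of \<open>m\<close>
  that comes from the complement of \<open>[a, b]\<close> occurs in both functions and cancels. On \<open>[a, b]\<close> the
  expansion \<open>1/(s - z) = \<alpha> - \<alpha>\<^sup>2 (s - c) + \<alpha>\<^sup>2 (s - c)\<^sup>2/(s - z)\<close> holds for the number \<open>s\<close> and
  likewise for the operator \<open>Y\<close>. The hypotheses on \<open>X\<close> and \<open>Y\<close> say that \<open>Q\<close> restricted to \<open>[a, b]\<close>
  and the sandwiched \<open>Y\<close> have the same moments of order 0 and 1, so the first two terms cancel as
  well. In each of the two remainders \<open>\<bar>\<alpha>\<bar> \<le> 1/L\<close>, the resolvent contributes another \<open>1/L\<close>, and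
  \<open>\<bar>s - c\<bar>\<close> and \<open>\<parallel>Y - c\<parallel>\<close> are at most \<open>r\<close>.

  The estimate is made on quadratic forms \<open>\<langle>Tx, x\<rangle>\<close>, where \<open>Q\<close> enters only through the positive
  measures \<open>E \<mapsto> \<langle>Q(E)x, x\<rangle>\<close>; the lemma \<open>norm_le_numerical_radius\<close> returns to the operator norm
  with a factor 2. The total is \<open>4 r\<^sup>2/L\<^sup>3 = (b - a)\<^sup>2/L\<^sup>3\<close> times \<open>\<parallel>Q([a, b])\<parallel>\<close>.

  Integrals, square roots and inverses of operators are specified by unique description, so each
  has to be shown to exist and to be unique. The integral of a bounded function is a norm limit of
  integrals of simple functions (\<open>op_integral\<close>), the square root a limit of the iteration \<open>P \<mapsto> (A
  + P\<^sup>2)/2\<close> with a scalar majorant (\<open>op_sqrt\<close>), and the resolvent of a self-adjoint operator a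
  Neumann series around a point far from the real axis (\<open>resolvent_right_inverse\<close>).
\<close>

section \<open>Inner product and quadratic forms\<close>

lemma cinner_add_right: "cinner x (y + z) = cinner x y + cinner x (z::'a::complex_hilbert_space)"
  by (metis cinner_add_left cinner_commute complex_cnj_add)

lemma cinner_scaleC_right: "cinner x (c *\<^sub>C y) = cnj c * cinner x (y::'a::complex_hilbert_space)"
  by (metis cinner_commute cinner_scaleC_left complex_cnj_mult)

lemma cinner_scaleR_left: "cinner (r *\<^sub>R x) y = of_real r * cinner x (y::'a::complex_hilbert_space)"
  by (simp add: scaleR_scaleC cinner_scaleC_left)

lemma cinner_scaleR_right: "cinner x (r *\<^sub>R y) = of_real r * cinner x
    (y::'a::complex_hilbert_space)"
  by (simp add: scaleR_scaleC cinner_scaleC_right)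

lemma cinner_minus_left: "cinner (- x) y = - cinner x (y::'a::complex_hilbert_space)"
  using cinner_scaleR_left[of "-1" x y] by simp

lemma cinner_minus_right: "cinner x (- y) = - cinner x (y::'a::complex_hilbert_space)"
  using cinner_scaleR_right[of x "-1" y] by simp

lemma cinner_diff_left: "cinner (x - y) z = cinner x z - cinner y (z::'a::complex_hilbert_space)"
  using cinner_add_left[of x "-y" z] by (simp add: cinner_minus_left)

lemma cinner_diff_right: "cinner x (y - z) = cinner x y - cinner x (z::'a::complex_hilbert_space)"
  using cinner_add_right[of x y "-z"] by (simp add: cinner_minus_right)

lemma cinner_zero_left [simp]: "cinner 0 (y::'a::complex_hilbert_space) = 0"
  using cinner_scaleR_left[of 0 0 y] by simp

lemma cinner_zero_right [simp]: "cinner (y::'a::complex_hilbert_space) 0 = 0"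
  using cinner_scaleR_right[of y 0 0] by simp

lemmas cinner_simps = cinner_add_left cinner_add_right cinner_diff_left cinner_diff_right
  cinner_minus_left cinner_minus_right cinner_scaleC_left cinner_scaleC_right
  cinner_scaleR_left cinner_scaleR_right

lemma cinner_sum_left: "cinner (sum f A) (y::'a::complex_hilbert_space) = (\<Sum>i\<in>A. cinner (f i) y)"
  by (induction A rule: infinite_finite_induct) (simp_all add: cinner_add_left)

lemma norm_sq_eq_Re_cinner: "(norm x)\<^sup>2 = Re (cinner x (x::'a::complex_hilbert_space))"
  by (simp add: cinner_self)

lemma scaleC_zero_left [simp]: "0 *\<^sub>C (x::'a::complex_hilbert_space) = 0"
  and scaleC_one [simp]: "1 *\<^sub>C (x::'a::complex_hilbert_space) = x"
  and scaleC_minus_left: "(- c) *\<^sub>C x = - (c *\<^sub>C (x::'a::complex_hilbert_space))"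
  using scaleR_scaleC[of 0 x] scaleR_scaleC[of 1 x] scaleR_scaleC[of "-1" "c *\<^sub>C x"]
  by (simp_all add: scaleC_scaleC)

lemma scaleC_diff_left: "(c - d) *\<^sub>C x = c *\<^sub>C x - d *\<^sub>C (x::'a::complex_hilbert_space)"
  using scaleC_add_left[of c "-d" x] by (simp add: scaleC_minus_left)

lemma scaleC_minus_right: "c *\<^sub>C (- x) = - (c *\<^sub>C (x::'a::complex_hilbert_space))"
  using scaleR_scaleC[of "-1" x] scaleR_scaleC[of "-1" "c *\<^sub>C x"]
  by (simp add: scaleC_scaleC mult.commute)

lemma scaleC_diff_right: "c *\<^sub>C (x - y) = c *\<^sub>C x - c *\<^sub>C (y::'a::complex_hilbert_space)"
  using scaleC_add_right[of c x "-y"] by (simp add: scaleC_minus_right)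

lemma scaleC_scaleR: "c *\<^sub>C (r *\<^sub>R x) = r *\<^sub>R (c *\<^sub>C (x::'a::complex_hilbert_space))"
  by (simp add: scaleR_scaleC scaleC_scaleC mult.commute)

lemma cinner_Cauchy_Schwarz: "cmod (cinner x y) \<le> norm x * norm (y::'a::complex_hilbert_space)"
proof (cases "y = 0")
  case False
  define n c where "n = (norm y)\<^sup>2" and "c = cinner x y"
  have n: "n > 0" using False by (simp add: n_def)
  have yx: "cinner y x = cnj c"
    unfolding c_def by (rule cinner_commute)
  have "cinner (n *\<^sub>R x - c *\<^sub>C y) (n *\<^sub>R x - c *\<^sub>C y)
      = complex_of_real (n\<^sup>2) * cinner x x + complex_of_real ((cmod c)\<^sup>2) * cinner y y
        - 2 * complex_of_real n * complex_of_real ((cmod c)\<^sup>2)"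
    unfolding complex_norm_square
    by (simp add: cinner_simps c_def[symmetric] yx cinner_self[of y] n_def power2_eq_square
        algebra_simps)
  then have "complex_of_real ((norm (n *\<^sub>R x - c *\<^sub>C y))\<^sup>2)
      = complex_of_real (n\<^sup>2 * (norm x)\<^sup>2 - n * (cmod c)\<^sup>2)"
    unfolding cinner_self n_def[symmetric] by (simp add: algebra_simps)
  then have "(norm (n *\<^sub>R x - c *\<^sub>C y))\<^sup>2 = n * (n * (norm x)\<^sup>2 - (cmod c)\<^sup>2)"
    unfolding of_real_eq_iff by (simp add: power2_eq_square algebra_simps)
  then have "n * (norm x)\<^sup>2 - (cmod c)\<^sup>2 \<ge> 0"
    using n by (metis zero_le_power2 zero_le_mult_iff less_le_not_le)
  then have "(cmod c)\<^sup>2 \<le> (norm x * norm y)\<^sup>2"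
    by (simp add: n_def power_mult_distrib mult.commute)
  then show ?thesis unfolding c_def
    by (meson mult_nonneg_nonneg norm_ge_zero power2_le_imp_le)
qed simp

lemma bounded_linear_cinner_left: "bounded_linear (\<lambda>x::'a::complex_hilbert_space. cinner x y)"
  by (rule bounded_linear_intro[where K = "norm y"])
    (simp_all add: cinner_simps cinner_Cauchy_Schwarz scaleR_conv_of_real)

lemmas tendsto_cinner_left = bounded_linear.tendsto[OF bounded_linear_cinner_left]

lemma norm_quadratic_form_le:
  "cmod (cinner (blinfun_apply T x) x) \<le> norm T * (norm (x::'a::complex_hilbert_space))\<^sup>2"
proof -
  have "cmod (cinner (blinfun_apply T x) x) \<le> norm (blinfun_apply T x) * norm x"
    by (rule cinner_Cauchy_Schwarz)
  also have "\<dots> \<le> (norm T * norm x) * norm x"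
    by (intro mult_right_mono norm_blinfun) auto
  finally show ?thesis by (simp add: power2_eq_square mult.assoc)
qed

lemma scaleC_zero_right [simp]: "c *\<^sub>C (0::'a::complex_hilbert_space) = 0"
  using scaleC_scaleR[of c 0 "0::'a"] by simp

lemma bounded_opsD:
  assumes "T \<in> bounded_ops" shows "blinfun_apply T (c *\<^sub>C x) = c *\<^sub>C blinfun_apply T x"
  using assms by (simp add: bounded_ops_def)

lemma bounded_ops_diff: "S \<in> bounded_ops \<Longrightarrow> T \<in> bounded_ops \<Longrightarrow> S - T \<in> bounded_ops"
  by (simp add: bounded_ops_def blinfun.bilinear_simps scaleC_diff_right)
lemma bounded_ops_add: "S \<in> bounded_ops \<Longrightarrow> T \<in> bounded_ops \<Longrightarrow> S + T \<in> bounded_ops"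
  by (simp add: bounded_ops_def blinfun.bilinear_simps scaleC_add_right)
lemma bounded_ops_scaleR: "T \<in> bounded_ops \<Longrightarrow> r *\<^sub>R T \<in> bounded_ops"
  by (simp add: bounded_ops_def blinfun.bilinear_simps scaleC_scaleR)
lemma bounded_ops_compose: "S \<in> bounded_ops \<Longrightarrow> T \<in> bounded_ops \<Longrightarrow> S o\<^sub>L T \<in> bounded_ops"
  by (simp add: bounded_ops_def)
lemma bounded_ops_zero: "0 \<in> bounded_ops"
  by (simp add: bounded_ops_def)
lemma bounded_ops_id: "id_blinfun \<in> bounded_ops"
  by (simp add: bounded_ops_def)
lemma bounded_ops_scalar: "scalar_op c \<in> bounded_ops"
  by (simp add: bounded_ops_def scalar_op.rep_eq scaleC_scaleC mult.commute)
lemmas bounded_ops_intros = bounded_ops_diff bounded_ops_add bounded_ops_scaleR bounded_ops_compose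
  bounded_ops_zero bounded_ops_id bounded_ops_scalar

lemma bounded_ops_sum: "(\<And>i. i \<in> I \<Longrightarrow> T i \<in> bounded_ops) \<Longrightarrow> sum T I \<in> bounded_ops"
  by (induction I rule: infinite_finite_induct) (auto intro: bounded_ops_intros)

lemma tendsto_blinfun_apply:
  "(T \<longlongrightarrow> T') F \<Longrightarrow> ((\<lambda>n. blinfun_apply (T n) x) \<longlongrightarrow> blinfun_apply T' x) F"
  by (intro tendsto_intros)

lemma bounded_ops_limit:
  fixes T :: "nat \<Rightarrow> 'a::complex_hilbert_space \<Rightarrow>\<^sub>L 'a"
  assumes "T \<longlonglongrightarrow> T'" "\<And>n. T n \<in> bounded_ops"
  shows "T' \<in> bounded_ops"
proof -
  have "blinfun_apply T' (c *\<^sub>C x) = c *\<^sub>C blinfun_apply T' x" for c x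
  proof (rule LIMSEQ_unique)
    show "(\<lambda>n. blinfun_apply (T n) (c *\<^sub>C x)) \<longlonglongrightarrow> blinfun_apply T' (c *\<^sub>C x)"
      by (rule tendsto_blinfun_apply[OF assms(1)])
    have "(\<lambda>n. scalar_op c (blinfun_apply (T n) x)) \<longlonglongrightarrow> scalar_op c (blinfun_apply T' x)"
      by (intro tendsto_intros tendsto_blinfun_apply[OF assms(1)])
    then show "(\<lambda>n. blinfun_apply (T n) (c *\<^sub>C x)) \<longlonglongrightarrow> c *\<^sub>C blinfun_apply T' x"
      using assms(2) by (simp add: scalar_op.rep_eq bounded_opsD)
  qed
  then show ?thesis by (simp add: bounded_ops_def)
qed

text \<open>
  The factor \<open>1/2\<close> sits on the vectors so that, with \<open>T = Q E\<close>, the sum is literally a combination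
  \<open>\<Sum> \<i>^k \<mu> k\<close> of positive measures, the shape in which the integral against a complex measure is
  given.
\<close>

lemma polarization:
  fixes T :: "'a::complex_hilbert_space \<Rightarrow>\<^sub>L 'a"
  assumes "T \<in> bounded_ops"
  shows "(\<Sum>k<4. \<i> ^ k * cinner (blinfun_apply T ((1/2) *\<^sub>R (x + (\<i> ^ k) *\<^sub>C y)))
           ((1/2) *\<^sub>R (x + (\<i> ^ k) *\<^sub>C y))) = cinner (blinfun_apply T x) y"
  by (simp add: eval_nat_numeral cinner_simps blinfun.bilinear_simps bounded_opsD[OF assms]
      algebra_simps)

lemma parallelogram:
  fixes x y :: "'a::complex_hilbert_space"
  shows "(norm (x + y))\<^sup>2 + (norm (x - y))\<^sup>2 = 2 * (norm x)\<^sup>2 + 2 * (norm y)\<^sup>2"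
  by (simp add: norm_sq_eq_Re_cinner cinner_simps)

text \<open>
  The two norm estimates below bound \<open>\<langle>Tx, y\<rangle>\<close> by a multiple of \<open>\<parallel>x\<parallel>\<^sup>2 + \<parallel>y\<parallel>\<^sup>2\<close>. Testing that with
  \<open>\<parallel>Tx\<parallel> x\<close> and \<open>\<parallel>x\<parallel> Tx\<close>, vectors of equal length, gives the homogeneous inequality assumed here.
\<close>

lemma norm_blinfun_leI:
  assumes "\<And>x. norm (blinfun_apply T x) > 0 \<Longrightarrow> norm x > 0 \<Longrightarrow>
      norm x * norm (blinfun_apply T x) * (norm (blinfun_apply T x))\<^sup>2 \<le> w *
          ((norm x)\<^sup>2 * (norm (blinfun_apply T x))\<^sup>2)"
    and "w \<ge> 0"
  shows "norm T \<le> w"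
proof (rule norm_blinfun_bound[OF assms(2)])
  fix x
  show "norm (blinfun_apply T x) \<le> w * norm x"
  proof (cases "blinfun_apply T x = 0")
    case False
    then have "x \<noteq> 0" by (metis blinfun.zero_right)
    with False assms(1)[of x] show ?thesis by (simp add: power2_eq_square mult_ac)
  qed (simp add: assms(2))
qed

text \<open>
  By polarization a bound on the quadratic form bounds the operator, at the price of a factor 2.
  Operator norms of integrals thereby reduce to scalar integrals against positive measures.
\<close>

lemma norm_le_numerical_radius:
  fixes T :: "'a::complex_hilbert_space \<Rightarrow>\<^sub>L 'a"
  assumes T: "T \<in> bounded_ops" and w: "\<And>x. cmod (cinner (blinfun_apply T x) x) \<le> w * (norm x)\<^sup>2"
    and "w \<ge> 0"
  shows "norm T \<le> 2 * w"
proof (rule norm_blinfun_leI)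
  have form: "cmod (cinner (blinfun_apply T x) y) \<le> w * ((norm x)\<^sup>2 + (norm y)\<^sup>2)" for x y
  proof -
    have "cmod (cinner (blinfun_apply T x) y) \<le>
        (\<Sum>k<4. w * (norm ((1/2) *\<^sub>R (x + (\<i> ^ k) *\<^sub>C y)))\<^sup>2)"
      unfolding polarization[OF T, of x y, symmetric]
      by (rule sum_norm_le) (simp only: norm_mult norm_power norm_ii power_one mult_1 w)
    also have "\<dots> = w / 4 * (((norm (x + y))\<^sup>2 + (norm (x - y))\<^sup>2)
       + ((norm (x + \<i> *\<^sub>C y))\<^sup>2 + (norm (x - \<i> *\<^sub>C y))\<^sup>2))"
      unfolding norm_scaleR power_mult_distrib
      by (simp add: eval_nat_numeral scaleC_minus_left algebra_simps)
    also have "\<dots> = w * ((norm x)\<^sup>2 + (norm y)\<^sup>2)"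
      by (subst (1 2) parallelogram) (simp add: norm_scaleC algebra_simps)
    finally show ?thesis .
  qed
  fix x
  define y where "y = blinfun_apply T x"
  have "cmod (cinner (blinfun_apply T (norm y *\<^sub>R x)) (norm x *\<^sub>R y)) \<le>
      w * ((norm (norm y *\<^sub>R x))\<^sup>2 + (norm (norm x *\<^sub>R y))\<^sup>2)"
    by (rule form)
  then show "norm x * norm (blinfun_apply T x) * (norm (blinfun_apply T x))\<^sup>2 \<le>
      2 * w * ((norm x)\<^sup>2 * (norm (blinfun_apply T x))\<^sup>2)"
    unfolding y_def[symmetric]
    by (simp add: blinfun.bilinear_simps y_def[symmetric] cinner_simps cinner_self norm_mult
        norm_power power_mult_distrib algebra_simps)
qed (simp add: assms)

lemma op_eqI_quadratic:
  fixes S T :: "'a::complex_hilbert_space \<Rightarrow>\<^sub>L 'a"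
  assumes "S \<in> bounded_ops" "T \<in> bounded_ops"
    and "\<And>x. cinner (blinfun_apply S x) x = cinner (blinfun_apply T x) x"
  shows "S = T"
proof -
  have "norm (S - T) \<le> 2 * 0"
    by (rule norm_le_numerical_radius)
      (simp_all add: assms bounded_ops_diff blinfun.bilinear_simps cinner_simps)
  then show ?thesis by simp
qed

text \<open>
  On a complex space a real quadratic form already forces symmetry: reality at \<open>x + y\<close> and \<open>x + \<i>
  y\<close> fixes the imaginary and the real part of \<open>\<langle>Tx, y\<rangle> - \<langle>x, Ty\<rangle>\<close>.
\<close>

lemma op_nonneg_iff:
  "op_nonneg T \<longleftrightarrow> op_selfadjoint T \<and> (\<forall>x. 0 \<le> Re (cinner (blinfun_apply T x) x))"
  (is "?l = ?r")
proof
  assume ?l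
  then have T: "T \<in> bounded_ops" and Im: "\<And>x. Im (cinner (blinfun_apply T x) x) = 0"
    and Re: "\<And>x. 0 \<le> Re (cinner (blinfun_apply T x) x)"
    by (auto simp: op_nonneg_def complex_nonneg_Reals_iff)
  have "cinner (blinfun_apply T x) y = cinner x (blinfun_apply T y)" for x y
  proof -
    have "Im (cinner (blinfun_apply T (x + c *\<^sub>C y)) (x + c *\<^sub>C y)) =
        Im (cnj c * cinner (blinfun_apply T x) y + c * cinner (blinfun_apply T y) x)" for c
      by (simp add: cinner_simps blinfun.bilinear_simps bounded_opsD[OF T] Im algebra_simps)
    from this[of 1] this[of \<i>] show ?thesis
      by (simp add: Im cinner_commute[of x] complex_eq_iff)
  qed
  with T Re show ?r by (simp add: op_selfadjoint_def)
next
  assume r: ?r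
  then have "cinner (blinfun_apply T x) x = cnj (cinner (blinfun_apply T x) x)" for x
    unfolding op_selfadjoint_def by (metis cinner_commute)
  then have "Im (cinner (blinfun_apply T x) x) = 0" for x
    by (metis Reals_cnj_iff complex_is_Real_iff)
  with r show ?l by (auto simp: op_nonneg_def op_selfadjoint_def complex_nonneg_Reals_iff)
qed

text \<open>
  For self-adjoint \<open>T\<close> two of the four polarization terms suffice, and the factor 2 of
  \<open>norm_le_numerical_radius\<close> disappears. The square root needs the constant 1: its iteration
  starts from a contraction \<open>I - X\<close>.
\<close>

lemma norm_selfadjoint_le:
  fixes T :: "'a::complex_hilbert_space \<Rightarrow>\<^sub>L 'a"
  assumes T: "op_selfadjoint T" and w: "\<And>x. \<bar>Re (cinner (blinfun_apply T x) x)\<bar> \<le> w * (norm x)\<^sup>2"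
    and "w \<ge> 0"
  shows "norm T \<le> w"
proof (rule norm_blinfun_leI)
  have form: "2 * Re (cinner (blinfun_apply T x) y) \<le> w * ((norm x)\<^sup>2 + (norm y)\<^sup>2)" for x y
  proof -
    have "cinner (blinfun_apply T y) x = cnj (cinner (blinfun_apply T x) y)"
      using T unfolding op_selfadjoint_def by (metis cinner_commute)
    then have "4 * Re (cinner (blinfun_apply T x) y) = Re (cinner (blinfun_apply T (x + y)) (x + y))
        - Re (cinner (blinfun_apply T (x - y)) (x - y))"
      by (simp add: cinner_simps blinfun.bilinear_simps)
    also have "\<dots> \<le> w * ((norm (x + y))\<^sup>2 + (norm (x - y))\<^sup>2)"
      using w[of "x + y"] w[of "x - y"] by (simp add: algebra_simps)
    also have "\<dots> = w * (2 * (norm x)\<^sup>2 + 2 * (norm y)\<^sup>2)"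
      by (subst parallelogram) simp_all
    finally show ?thesis by (simp add: algebra_simps)
  qed
  fix x
  define y where "y = blinfun_apply T x"
  have "2 * Re (cinner (blinfun_apply T (norm y *\<^sub>R x)) (norm x *\<^sub>R y)) \<le>
      w * ((norm (norm y *\<^sub>R x))\<^sup>2 + (norm (norm x *\<^sub>R y))\<^sup>2)"
    by (rule form)
  then show "norm x * norm (blinfun_apply T x) * (norm (blinfun_apply T x))\<^sup>2 \<le>
      w * ((norm x)\<^sup>2 * (norm (blinfun_apply T x))\<^sup>2)"
    unfolding y_def[symmetric]
    by (simp add: blinfun.bilinear_simps y_def[symmetric] cinner_simps cinner_self
        power_mult_distrib algebra_simps)
qed (simp add: assms)

section \<open>The square root of a non-negative operator\<close>

lemma blinfun_compose_assoc: "(f o\<^sub>L g) o\<^sub>L h = f o\<^sub>L (g o\<^sub>L h)"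
  by (rule blinfun_eqI) simp

lemma blinfun_compose_id [simp]: "f o\<^sub>L id_blinfun = f" "id_blinfun o\<^sub>L f = f"
  by (auto intro: blinfun_eqI)

lemmas compose_simps =
  bounded_bilinear.add_left[OF bounded_bilinear_blinfun_compose]
  bounded_bilinear.add_right[OF bounded_bilinear_blinfun_compose]
  bounded_bilinear.diff_left[OF bounded_bilinear_blinfun_compose]
  bounded_bilinear.diff_right[OF bounded_bilinear_blinfun_compose]
  bounded_bilinear.scaleR_left[OF bounded_bilinear_blinfun_compose]
  bounded_bilinear.scaleR_right[OF bounded_bilinear_blinfun_compose]

lemmas tendsto_blinfun_compose = bounded_bilinear.tendsto[OF bounded_bilinear_blinfun_compose]

lemma op_selfadjoint_limit:
  fixes T :: "nat \<Rightarrow> 'a::complex_hilbert_space \<Rightarrow>\<^sub>L 'a"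
  assumes T: "T \<longlonglongrightarrow> T'" and sa: "\<And>n. op_selfadjoint (T n)"
  shows "op_selfadjoint T'"
proof -
  have "cinner (blinfun_apply T' x) y = cinner x (blinfun_apply T' y)" for x y
  proof (rule LIMSEQ_unique)
    show "(\<lambda>n. cinner (blinfun_apply (T n) x) y) \<longlonglongrightarrow> cinner (blinfun_apply T' x) y"
      by (intro tendsto_cinner_left tendsto_blinfun_apply T)
    have "(\<lambda>n. cnj (cinner (blinfun_apply (T n) y) x)) \<longlonglongrightarrow> cnj (cinner (blinfun_apply T' y) x)"
      by (intro tendsto_cnj tendsto_cinner_left tendsto_blinfun_apply T)
    then show "(\<lambda>n. cinner (blinfun_apply (T n) x) y) \<longlonglongrightarrow> cinner x (blinfun_apply T' y)"
      using sa by (simp add: op_selfadjoint_def flip: cinner_commute)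
  qed
  with bounded_ops_limit[OF T] sa show ?thesis by (simp add: op_selfadjoint_def)
qed

text \<open>
  If \<open>P = (A + P\<^sup>2) / 2\<close> with \<open>A = I - X\<close>, then \<open>(I - P)\<^sup>2 = X\<close>. The fixed point is reached by
  iteration from 0.
\<close>

primrec sqrt_iter :: "('a::real_normed_vector \<Rightarrow>\<^sub>L 'a) \<Rightarrow> nat \<Rightarrow> ('a \<Rightarrow>\<^sub>L 'a)" where
  "sqrt_iter A 0 = 0"
| "sqrt_iter A (Suc n) = (1/2) *\<^sub>R (A + (sqrt_iter A n o\<^sub>L sqrt_iter A n))"

text \<open>
  The same iteration for the scalar 1 in place of \<open>A\<close>. Its increments dominate the norms of the
  operator increments, and it converges because it is monotone and bounded; this makes the
  operator iteration Cauchy in norm.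
\<close>

primrec sqrt_majorant :: "nat \<Rightarrow> real" where
  "sqrt_majorant 0 = 0"
| "sqrt_majorant (Suc n) = (1 + (sqrt_majorant n)\<^sup>2) / 2"

lemma sqrt_majorant_bounds: "0 \<le> sqrt_majorant n \<and> sqrt_majorant n \<le> 1"
  by (induction n) (auto simp: power_le_one)

lemma sqrt_majorant_incseq: "incseq sqrt_majorant"
proof (rule incseq_SucI)
  fix n
  have "0 \<le> (1 - sqrt_majorant n)\<^sup>2" by simp
  then show "sqrt_majorant n \<le> sqrt_majorant (Suc n)"
    by (simp add: power2_eq_square algebra_simps)
qed

lemma norm_sqrt_iter:
  assumes "norm A \<le> 1"
  shows "norm (sqrt_iter A n) \<le> sqrt_majorant n"
proof (induction n)
  case (Suc n)
  have "norm (sqrt_iter A (Suc n)) \<le> (norm A + norm (sqrt_iter A n) * norm (sqrt_iter A n)) / 2"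
    using norm_triangle_ineq[of A "sqrt_iter A n o\<^sub>L sqrt_iter A n"]
      norm_blinfun_compose[of "sqrt_iter A n" "sqrt_iter A n"] by simp
  also have "\<dots> \<le> (1 + sqrt_majorant n * sqrt_majorant n) / 2"
    using assms mult_mono[OF Suc Suc] sqrt_majorant_bounds[of n] by simp
  finally show ?case by (simp add: power2_eq_square)
qed simp

text \<open>
  Induction by way of \<open>P'\<^sup>2 - P\<^sup>2 = P'(P' - P) + (P' - P)P\<close>; for the scalar majorant the
  corresponding estimate \<open>(p' + p)(p' - p)\<close> is exactly the next increment, up to the common factor
  \<open>1/2\<close>.
\<close>

lemma norm_sqrt_iter_step:
  assumes "norm A \<le> 1"
  shows "norm (sqrt_iter A (Suc n) - sqrt_iter A n) \<le> sqrt_majorant (Suc n) - sqrt_majorant n"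
proof (induction n)
  case (Suc n)
  define P P' p p' where "P = sqrt_iter A n" and "P' = sqrt_iter A (Suc n)"
    and "p = sqrt_majorant n" and "p' = sqrt_majorant (Suc n)"
  have bounds: "norm P \<le> p" "norm P' \<le> p'" "norm (P' - P) \<le> p' - p" "0 \<le> p" "0 \<le> p'"
    using norm_sqrt_iter[OF assms] Suc sqrt_majorant_bounds
    unfolding P_def P'_def p_def p'_def by blast+
  have "sqrt_iter A (Suc (Suc n)) - sqrt_iter A (Suc n)
      = (1/2) *\<^sub>R (A + (P' o\<^sub>L P')) - (1/2) *\<^sub>R (A + (P o\<^sub>L P))"
    by (simp add: P_def P'_def)
  also have "\<dots> = (1/2) *\<^sub>R ((P' o\<^sub>L (P' - P)) + ((P' - P) o\<^sub>L P))"
    by (simp add: compose_simps flip: scaleR_diff_right)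
  finally have "norm (sqrt_iter A (Suc (Suc n)) - sqrt_iter A (Suc n))
      \<le> (norm P' * norm (P' - P) + norm (P' - P) * norm P) / 2"
    using norm_triangle_ineq[of "P' o\<^sub>L (P' - P)" "(P' - P) o\<^sub>L P"]
      norm_blinfun_compose[of P' "P' - P"] norm_blinfun_compose[of "P' - P" P] by simp
  also have "\<dots> \<le> (p' * (p' - p) + (p' - p) * p) / 2"
    using bounds order_trans[OF norm_ge_zero bounds(3)]
    by (intro divide_right_mono add_mono mult_mono) auto
  also have "\<dots> = sqrt_majorant (Suc (Suc n)) - sqrt_majorant (Suc n)"
    by (simp add: p'_def[symmetric] del: sqrt_majorant.simps(2))
      (simp add: p_def p'_def power2_eq_square algebra_simps)
  finally show ?case .
qed (use assms in simp)

lemma sqrt_iter_convergent: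
  fixes A :: "'a::banach \<Rightarrow>\<^sub>L 'a"
  assumes "norm A \<le> 1"
  shows "convergent (sqrt_iter A)"
proof -
  have gap: "norm (sqrt_iter A (n + k) - sqrt_iter A n) \<le> sqrt_majorant (n + k) - sqrt_majorant
      n" for n k
  proof (induction k)
    case (Suc k)
    then show ?case
      using norm_triangle_ineq[of "sqrt_iter A (Suc (n + k)) - sqrt_iter A (n + k)"
          "sqrt_iter A (n + k) - sqrt_iter A n"]
        norm_sqrt_iter_step[OF assms, of "n + k"] by (simp del: sqrt_iter.simps sqrt_majorant.simps)
  qed simp
  have "Cauchy sqrt_majorant"
    using incseq_convergent[OF sqrt_majorant_incseq, of 1] sqrt_majorant_bounds
    by (metis LIMSEQ_imp_Cauchy)
  then have "Cauchy (sqrt_iter A)"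
    unfolding Cauchy_altdef2 dist_norm
  proof (intro allI impI)
    fix e :: real assume "e > 0"
    then obtain N where N: "\<forall>n\<ge>N. norm (sqrt_majorant n - sqrt_majorant N) < e"
      using \<open>Cauchy sqrt_majorant\<close> unfolding Cauchy_altdef2 dist_norm by blast
    have "norm (sqrt_iter A n - sqrt_iter A N) < e" if "n \<ge> N" for n
      using gap[of N "n - N"] N[rule_format, OF that] that by simp
    then show "\<exists>N. \<forall>n\<ge>N. norm (sqrt_iter A n - sqrt_iter A N) < e" by blast
  qed
  then show ?thesis by (rule Cauchy_convergent)
qed

lemma commute_sqrt_iter:
  assumes "R o\<^sub>L A = A o\<^sub>L R"
  shows "R o\<^sub>L sqrt_iter A n = sqrt_iter A n o\<^sub>L R"
proof (induction n)
  case (Suc n)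
  have "R o\<^sub>L (sqrt_iter A n o\<^sub>L sqrt_iter A n) = (sqrt_iter A n o\<^sub>L sqrt_iter A n) o\<^sub>L R"
    by (metis Suc blinfun_compose_assoc)
  then show ?case by (simp add: compose_simps assms)
qed simp

lemma selfadjoint_sqrt_iter:
  assumes "op_selfadjoint A"
  shows "op_selfadjoint (sqrt_iter A n)"
proof (induction n)
  case (Suc n)
  then show ?case using assms
    by (simp add: op_selfadjoint_def bounded_ops_intros blinfun.bilinear_simps cinner_simps)
qed (simp add: op_selfadjoint_def bounded_ops_intros)

text \<open>
  The root \<open>S = I - P\<close> is non-negative because \<open>\<parallel>P\<parallel> \<le> 1\<close>. Being a limit of polynomials in \<open>X\<close>, it
  commutes with everything that commutes with \<open>X\<close>; uniqueness of the root rests on this.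
\<close>

lemma op_sqrt_exists_contraction:
  fixes X :: "'a::complex_hilbert_space \<Rightarrow>\<^sub>L 'a"
  assumes sa: "op_selfadjoint X" and le: "norm (id_blinfun - X) \<le> 1"
  shows "\<exists>S. op_nonneg S \<and> S o\<^sub>L S = X \<and> (\<forall>R. R o\<^sub>L X = X o\<^sub>L R \<longrightarrow> R o\<^sub>L S = S o\<^sub>L R)"
proof -
  define A where "A = id_blinfun - X"
  have A: "op_selfadjoint A" "norm A \<le> 1"
    using sa le by (simp_all add: A_def op_selfadjoint_def bounded_ops_intros
        blinfun.bilinear_simps cinner_simps)
  obtain P where P: "sqrt_iter A \<longlonglongrightarrow> P"
    using sqrt_iter_convergent[OF A(2)] by (auto simp: convergent_def)
  have normP: "norm P \<le> 1"
    by (rule LIMSEQ_le_const2[OF tendsto_norm[OF P]])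
      (use norm_sqrt_iter[OF A(2)] sqrt_majorant_bounds order_trans in blast)
  have saP: "op_selfadjoint P"
    using op_selfadjoint_limit[OF P] selfadjoint_sqrt_iter[OF A(1)] by blast
  have "P = (1/2) *\<^sub>R (A + (P o\<^sub>L P))"
  proof (rule LIMSEQ_unique)
    show "(\<lambda>n. sqrt_iter A (Suc n)) \<longlonglongrightarrow> P" using P by (rule LIMSEQ_Suc)
    show "(\<lambda>n. sqrt_iter A (Suc n)) \<longlonglongrightarrow> (1/2) *\<^sub>R (A + (P o\<^sub>L P))"
      unfolding sqrt_iter.simps by (intro tendsto_intros tendsto_blinfun_compose P)
  qed
  from arg_cong[OF this, of "\<lambda>T. 2 *\<^sub>R T"] have fix_eq: "2 *\<^sub>R P = A + (P o\<^sub>L P)"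
    by simp
  define S where "S = id_blinfun - P"
  have "S o\<^sub>L S = id_blinfun - 2 *\<^sub>R P + (P o\<^sub>L P)"
    by (rule blinfun_eqI) (simp add: S_def blinfun.bilinear_simps scaleR_2 algebra_simps)
  also have "\<dots> = X" by (simp add: fix_eq A_def)
  finally have sq: "S o\<^sub>L S = X" .
  have "0 \<le> Re (cinner (blinfun_apply S x) x)" for x
  proof -
    have "Re (cinner (blinfun_apply P x) x) \<le> norm P * (norm x)\<^sup>2"
      by (rule order_trans[OF complex_Re_le_cmod norm_quadratic_form_le])
    also have "\<dots> \<le> 1 * (norm x)\<^sup>2" using normP by (intro mult_right_mono) auto
    finally show ?thesis
      by (simp add: S_def blinfun.bilinear_simps cinner_simps cinner_self power2_eq_square)
  qed
  moreover have "op_selfadjoint S"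
    using saP by (simp add: S_def op_selfadjoint_def bounded_ops_intros blinfun.bilinear_simps
        cinner_simps)
  ultimately have "op_nonneg S" by (simp add: op_nonneg_iff)
  moreover have "R o\<^sub>L S = S o\<^sub>L R" if "R o\<^sub>L X = X o\<^sub>L R" for R
  proof -
    have RA: "R o\<^sub>L A = A o\<^sub>L R"
      unfolding A_def compose_simps that by (auto intro: blinfun_eqI)
    have "R o\<^sub>L P = P o\<^sub>L R"
    proof (rule LIMSEQ_unique)
      show "(\<lambda>n. R o\<^sub>L sqrt_iter A n) \<longlonglongrightarrow> (R o\<^sub>L P)"
        by (intro tendsto_blinfun_compose P tendsto_const)
      show "(\<lambda>n. R o\<^sub>L sqrt_iter A n) \<longlonglongrightarrow> (P o\<^sub>L R)"
        unfolding commute_sqrt_iter[OF RA] by (intro tendsto_blinfun_compose P tendsto_const)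
    qed
    then show ?thesis unfolding S_def compose_simps by (auto intro: blinfun_eqI)
  qed
  ultimately show ?thesis using sq by blast
qed

text \<open>
  After division by a number above \<open>\<parallel>X\<parallel>\<close> the form of \<open>X\<close> lies between 0 and \<open>\<parallel>x\<parallel>\<^sup>2\<close>, so that \<open>I -
  X\<close> is a contraction. The divisor \<open>\<parallel>X\<parallel> + 1\<close> also covers \<open>X = 0\<close>.
\<close>

lemma op_sqrt_exists:
  fixes X :: "'a::complex_hilbert_space \<Rightarrow>\<^sub>L 'a"
  assumes "op_nonneg X"
  shows "\<exists>S. op_nonneg S \<and> S o\<^sub>L S = X \<and> (\<forall>R. R o\<^sub>L X = X o\<^sub>L R \<longrightarrow> R o\<^sub>L S = S o\<^sub>L R)"
proof -
  define k where "k = norm X + 1"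
  have k: "k > 0" using norm_ge_zero[of X] unfolding k_def by linarith
  define Z where "Z = (1/k) *\<^sub>R X"
  have X: "op_selfadjoint X" "0 \<le> Re (cinner (blinfun_apply X x) x)" for x
    using assms by (auto simp: op_nonneg_iff)
  have Z: "op_selfadjoint Z"
    using X(1) by (simp add: Z_def op_selfadjoint_def bounded_ops_intros blinfun.bilinear_simps
        cinner_simps)
  have "norm (id_blinfun - Z) \<le> 1"
  proof (rule norm_selfadjoint_le)
    show "op_selfadjoint (id_blinfun - Z)"
      using Z by (simp add: op_selfadjoint_def bounded_ops_intros blinfun.bilinear_simps
          cinner_simps)
    fix x
    have "Re (cinner (blinfun_apply X x) x) \<le> norm X * (norm x)\<^sup>2"
      by (rule order_trans[OF complex_Re_le_cmod norm_quadratic_form_le])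
    also have "\<dots> \<le> k * (norm x)\<^sup>2" by (intro mult_right_mono) (auto simp: k_def)
    finally have "Re (cinner (blinfun_apply X x) x) / k \<le> (norm x)\<^sup>2"
        "Re (cinner (blinfun_apply X x) x) / k \<ge> 0"
      using k X(2) by (simp_all add: field_simps power2_eq_square)
    then show "\<bar>Re (cinner (blinfun_apply (id_blinfun - Z) x) x)\<bar> \<le> 1 * (norm x)\<^sup>2"
      by (simp add: Z_def blinfun.bilinear_simps cinner_simps cinner_self)
  qed simp
  from op_sqrt_exists_contraction[OF Z this] obtain S where S: "op_nonneg S" "S o\<^sub>L S = Z"
    and comm: "\<And>R. R o\<^sub>L Z = Z o\<^sub>L R \<Longrightarrow> R o\<^sub>L S = S o\<^sub>L R" by blast
  define T where "T = sqrt k *\<^sub>R S"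
  have "op_nonneg T"
    using S(1) k by (auto simp: T_def op_nonneg_iff op_selfadjoint_def bounded_ops_intros
        blinfun.bilinear_simps cinner_simps)
  moreover have "T o\<^sub>L T = X"
    using k by (simp add: T_def compose_simps S(2)) (simp add: Z_def)
  moreover have "R o\<^sub>L T = T o\<^sub>L R" if "R o\<^sub>L X = X o\<^sub>L R" for R
    using comm[of R] that by (simp add: T_def Z_def compose_simps)
  ultimately show ?thesis by blast
qed

text \<open>
  Put \<open>D = S - R\<close>. Commutation gives \<open>(S + R)D = S\<^sup>2 - R\<^sup>2 = 0\<close>, so the two non-negative forms of
  \<open>S\<close> and \<open>R\<close> have sum zero on the range of \<open>D\<close> and vanish there separately. Their difference is
  the form of \<open>D\<^sup>3\<close>; hence \<open>D\<^sup>3 = 0\<close>, and a nilpotent self-adjoint operator is zero.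
\<close>

lemma op_nonneg_sqrt_unique:
  fixes S R :: "'a::complex_hilbert_space \<Rightarrow>\<^sub>L 'a"
  assumes S: "op_nonneg S" and R: "op_nonneg R" and sq: "S o\<^sub>L S = R o\<^sub>L R" and comm:
      "R o\<^sub>L S = S o\<^sub>L R"
  shows "R = S"
proof -
  define D where "D = S - R"
  have D: "op_selfadjoint D" and Dops: "D \<in> bounded_ops"
    using S R by (simp_all add: D_def op_nonneg_iff op_selfadjoint_def bounded_ops_intros
        blinfun.bilinear_simps cinner_simps)
  have Dadj: "cinner (blinfun_apply D x) y = cinner x (blinfun_apply D y)" for x y
    using D by (simp add: op_selfadjoint_def)
  have SRD: "(S + R) o\<^sub>L D = 0"
    by (simp add: D_def compose_simps sq comm)
  have zero: "cinner (blinfun_apply D (blinfun_apply D x)) (blinfun_apply D x) = 0" for x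
  proof -
    define y where "y = blinfun_apply D x"
    have "cinner (blinfun_apply S y) y + cinner (blinfun_apply R y) y
        = cinner (blinfun_apply ((S + R) o\<^sub>L D) x) y"
      by (simp add: y_def[symmetric] blinfun.add_left cinner_add_left)
    then have "cinner (blinfun_apply S y) y + cinner (blinfun_apply R y) y = 0"
      by (simp add: SRD)
    moreover have "cinner (blinfun_apply S y) y \<in> \<real>\<^sub>\<ge>\<^sub>0" "cinner (blinfun_apply R y) y \<in> \<real>\<^sub>\<ge>\<^sub>0"
      using S R by (simp_all add: op_nonneg_def)
    ultimately have "cinner (blinfun_apply S y) y = 0" "cinner (blinfun_apply R y) y = 0"
      by (auto simp: complex_nonneg_Reals_iff complex_eq_iff)
    moreover have "blinfun_apply D y = blinfun_apply S y - blinfun_apply R y"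
      by (simp add: D_def blinfun.diff_left)
    ultimately show ?thesis by (simp add: y_def[symmetric] cinner_diff_left)
  qed
  have "D o\<^sub>L D o\<^sub>L D = 0"
    by (rule op_eqI_quadratic) (use zero Dops in \<open>simp_all add: bounded_ops_intros Dadj\<close>)
  then have D3: "blinfun_apply D (blinfun_apply D (blinfun_apply D x)) = 0" for x
    by (metis blinfun_apply_blinfun_compose blinfun.zero_left)
  have D2: "blinfun_apply D (blinfun_apply D x) = 0" for x
  proof -
    have "cinner (blinfun_apply D (blinfun_apply D x)) (blinfun_apply D (blinfun_apply D x)) = 0"
      by (subst Dadj) (simp add: D3)
    then show ?thesis by (simp add: cinner_self)
  qed
  have "blinfun_apply D x = 0" for x
  proof -
    have "cinner (blinfun_apply D x) (blinfun_apply D x) = 0"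
      by (subst Dadj) (simp add: D2)
    then show ?thesis by (simp add: cinner_self)
  qed
  then have "D = 0" by (auto intro: blinfun_eqI)
  then show ?thesis by (simp add: D_def)
qed

lemma op_sqrt:
  fixes X :: "'a::complex_hilbert_space \<Rightarrow>\<^sub>L 'a"
  assumes "op_nonneg X"
  shows "op_nonneg (op_sqrt X)" "op_sqrt X o\<^sub>L op_sqrt X = X"
proof -
  obtain S where S: "op_nonneg S" "S o\<^sub>L S = X"
    and comm: "\<And>R. R o\<^sub>L X = X o\<^sub>L R \<Longrightarrow> R o\<^sub>L S = S o\<^sub>L R"
    using op_sqrt_exists[OF assms] by blast
  have "R = S" if "op_nonneg R" "R o\<^sub>L R = X" for R
    using op_nonneg_sqrt_unique[OF S(1) that(1)] comm[of R] S(2) that(2)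
    by (metis blinfun_compose_assoc)
  with S have "op_sqrt X = S" unfolding op_sqrt_def by (intro the_equality) blast+
  with S show "op_nonneg (op_sqrt X)" "op_sqrt X o\<^sub>L op_sqrt X = X" by simp_all
qed

section \<open>Operator-valued integrals of bounded functions\<close>

lemma norm_integral_le_measure:
  fixes h :: "real \<Rightarrow> complex"
  assumes M: "finite_measure M" "sets M = sets borel" and h: "h \<in> borel_measurable borel"
    and A: "A \<in> sets borel" and bound: "\<And>s. cmod (h s) \<le> e * indicator A s"
  shows "integrable M h" "cmod (LINT s|M. h s) \<le> e * measure M A"
proof -
  interpret finite_measure M by fact
  have hM: "h \<in> borel_measurable M"
    using h M(2) by (simp cong: measurable_cong_sets)
  have AM: "A \<in> sets M" using A M(2) by simp
  have ind: "integrable M (\<lambda>s. e * indicator A s)"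
    using AM by (intro integrable_mult_right integrable_real_indicator)
        (auto simp: emeasure_eq_measure)
  show int: "integrable M h"
    by (rule Bochner_Integration.integrable_bound[OF ind hM])
        (auto intro!: AE_I2 order_trans[OF bound] )
  have "cmod (LINT s|M. h s) \<le> (LINT s|M. cmod (h s))"
    by (rule integral_norm_bound)
  also have "\<dots> \<le> (LINT s|M. e * indicator A s)"
    by (rule integral_mono) (use int ind bound in auto)
  also have "\<dots> = e * measure M A"
    using AM sets.sets_into_space[OF AM] by (simp add: Int_absorb2)
  finally show "cmod (LINT s|M. h s) \<le> e * measure M A" .
qed

definition simple_sum :: "(real set \<Rightarrow> complex) \<Rightarrow> (real \<Rightarrow> complex) \<Rightarrow> complex" where
  "simple_sum \<nu> g = (\<Sum>c\<in>range g. c * \<nu> (g -` {c}))"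

lemma vimage_singleton_borel:
  assumes "(g :: real \<Rightarrow> complex) \<in> borel_measurable borel"
  shows "g -` {c} \<in> sets borel"
  using measurable_sets[OF assms, of "{c}"] by simp

lemma integral_eq_simple_sum:
  fixes g :: "real \<Rightarrow> complex"
  assumes M: "finite_measure M" "sets M = sets borel" and g: "g \<in> borel_measurable borel"
    and fin: "finite (range g)"
  shows "(LINT s|M. g s) = simple_sum (\<lambda>E. complex_of_real (measure M E)) g"
proof -
  interpret finite_measure M by fact
  have sp: "space M = UNIV" using sets_eq_imp_space_eq[OF M(2)] by simp
  have lev: "g -` {c} \<in> sets M" for c using vimage_singleton_borel[OF g] M(2) by simp
  have "(LINT s|M. g s) = (LINT s|M. (\<Sum>c\<in>range g. indicator (g -` {c}) s *\<^sub>R c))"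
  proof (rule arg_cong[of _ _ "lebesgue_integral M"], rule ext)
    fix s
    have "(\<Sum>c\<in>range g. indicator (g -` {c}) s *\<^sub>R c) = (\<Sum>c\<in>range g. if c = g s then c else 0)"
      by (rule sum.cong) (auto simp: indicator_def)
    then show "g s = (\<Sum>c\<in>range g. indicator (g -` {c}) s *\<^sub>R c)" using fin by simp
  qed
  also have "\<dots> = (\<Sum>c\<in>range g. LINT s|M. indicator (g -` {c}) s *\<^sub>R c)"
    using lev by (intro Bochner_Integration.integral_sum integrable_scaleR_left
        integrable_real_indicator)
      (auto simp: emeasure_eq_measure)
  also have "\<dots> = (\<Sum>c\<in>range g. measure M (g -` {c}) *\<^sub>R c)"
    using lev by (intro sum.cong refl, subst integral_scaleR_left)
      (auto simp: sp emeasure_eq_measure)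
  finally show ?thesis
    by (simp add: simple_sum_def scaleR_conv_of_real mult.commute)
qed

lemma uniform_simple_approximation:
  fixes f :: "real \<Rightarrow> complex"
  assumes f: "f \<in> borel_measurable borel" and B: "\<And>s. cmod (f s) \<le> B" and "e > 0"
  shows "\<exists>g \<in> borel_measurable borel. finite (range g) \<and> (\<forall>s. cmod (f s - g s) \<le> e)"
proof -
  \<comment> \<open>the range is rounded down to a square grid of mesh \<open>d\<close>; real and imaginary part cost \<open>d\<close> each\<close>
  define d where "d = e / 2"
  define N where "N = \<lceil>B / d\<rceil>"
  define grid where "grid i j = complex_of_real (d * of_int i) + \<i> * complex_of_real
      (d * of_int j)" for i j
  define g where "g s = grid \<lfloor>Re (f s) / d\<rfloor> \<lfloor>Im (f s) / d\<rfloor>" for s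
  have d: "d > 0" using \<open>e > 0\<close> by (simp add: d_def)
  have "g \<in> borel_measurable borel"
    unfolding g_def grid_def using f by measurable
  moreover have "finite (range g)"
  proof (rule finite_subset)
    have cell: "\<lfloor>x / d\<rfloor> \<in> {- N..N}" if "\<bar>x\<bar> \<le> B" for x
    proof -
      have "\<bar>x / d\<bar> \<le> real_of_int N"
        using that d unfolding N_def by (simp add: abs_divide)
            (meson divide_right_mono less_imp_le order_trans le_of_int_ceiling)
      then have "- real_of_int N \<le> x / d" "x / d < real_of_int N + 1" by linarith+
      then show ?thesis by (simp add: le_floor_iff floor_le_iff)
    qed
    have "\<bar>Re (f s)\<bar> \<le> B" "\<bar>Im (f s)\<bar> \<le> B" for s
      using abs_Re_le_cmod abs_Im_le_cmod B order_trans by blast+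
    then show "range g \<subseteq> (\<lambda>(i, j). grid i j) ` ({- N..N} \<times> {- N..N})"
      unfolding g_def using cell by blast
  qed simp
  moreover have "cmod (f s - g s) \<le> e" for s
  proof -
    have cell: "\<bar>x - d * of_int \<lfloor>x / d\<rfloor>\<bar> \<le> d" for x
    proof -
      have "x / d - of_int \<lfloor>x / d\<rfloor> \<ge> 0" "x / d - of_int \<lfloor>x / d\<rfloor> \<le> 1" by linarith+
      then show ?thesis using d by (simp add: field_simps abs_le_iff)
    qed
    have "cmod (f s - g s) \<le> \<bar>Re (f s - g s)\<bar> + \<bar>Im (f s - g s)\<bar>" by (rule cmod_le)
    also have "\<dots> \<le> d + d"
      using cell[of "Re (f s)"] cell[of "Im (f s)"] by (intro add_mono)
          (simp_all add: g_def grid_def)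
    finally show ?thesis by (simp add: d_def)
  qed
  ultimately show ?thesis by blast
qed

text \<open>
  The sum over the level sets of a simple \<open>g\<close> sees only \<open>\<nu>\<close>, not the measures into which \<open>\<nu>\<close> was
  decomposed. Since such sums approximate every integral of \<open>f\<close>, the integral of a bounded
  function does not depend on the decomposition.
\<close>

lemma has_complex_measure_integral_approx:
  assumes "has_complex_measure_integral \<nu> f I" and f: "f \<in> borel_measurable borel"
  obtains K where "K \<ge> 0" "\<And>g e. g \<in> borel_measurable borel \<Longrightarrow> finite (range g) \<Longrightarrow>
    (\<And>s. cmod (f s - g s) \<le> e) \<Longrightarrow> cmod (I - simple_sum \<nu> g) \<le> e * K"
proof -
  obtain \<mu> where \<mu>: "\<And>k. k < 4 \<Longrightarrow> finite_measure (\<mu> k)" "\<And>k. k < 4 \<Longrightarrow> sets (\<mu> k) = sets borel"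
      "\<And>k. k < 4 \<Longrightarrow> integrable (\<mu> k) f"
    and \<nu>: "\<And>E. E \<in> sets borel \<Longrightarrow> \<nu> E = (\<Sum>k<4. \<i> ^ k * complex_of_real (measure (\<mu> k) E))"
    and I: "I = (\<Sum>k<4. \<i> ^ k * (LINT s|\<mu> k. f s))"
    using assms(1) unfolding has_complex_measure_integral_def by blast
  show thesis
  proof (rule that)
    show "0 \<le> (\<Sum>k<(4::nat). measure (\<mu> k) UNIV)" by (simp add: sum_nonneg)
    fix g e
    assume g: "g \<in> borel_measurable borel" "finite (range g)" and e: "\<And>s. cmod (f s - g s) \<le> e"
    have "simple_sum \<nu> g = (\<Sum>c\<in>range g. \<Sum>k<4. \<i> ^ k *
        (c * complex_of_real (measure (\<mu> k) (g -` {c}))))"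
      unfolding simple_sum_def by (simp add: \<nu> vimage_singleton_borel[OF g(1)] sum_distrib_left
          mult_ac)
    also have "\<dots> = (\<Sum>k<4. \<i> ^ k * simple_sum (\<lambda>E. complex_of_real (measure (\<mu> k) E)) g)"
      unfolding simple_sum_def by (subst sum.swap) (simp add: sum_distrib_left)
    also have "\<dots> = (\<Sum>k<4. \<i> ^ k * (LINT s|\<mu> k. g s))"
      using \<mu> g by (intro sum.cong refl) (simp add: integral_eq_simple_sum)
    finally have "I - simple_sum \<nu> g = (\<Sum>k<4. \<i> ^ k * ((LINT s|\<mu> k. f s) - (LINT s|\<mu> k. g s)))"
      by (simp add: I sum_subtractf right_diff_distrib)
    also have "cmod \<dots> \<le> (\<Sum>k<4. e * measure (\<mu> k) UNIV)"
    proof (rule sum_norm_le)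
      fix k :: nat assume "k \<in> {..<4}"
      then have k: "k < 4" by simp
      have diff: "(\<lambda>s. f s - g s) \<in> borel_measurable borel" using f g by simp
      note bound = norm_integral_le_measure[OF \<mu>(1,2)[OF k] diff, where A = UNIV and e = e,
          simplified, OF e]
      have "integrable (\<mu> k) g"
        using Bochner_Integration.integrable_diff[OF \<mu>(3)[OF k] bound(1)] by simp
      then show "cmod (\<i> ^ k * ((LINT s|\<mu> k. f s) - (LINT s|\<mu> k. g s))) \<le> e * measure (\<mu> k) UNIV"
        using bound(2) \<mu>(3)[OF k] by (simp add: norm_mult norm_power)
    qed
    finally show "cmod (I - simple_sum \<nu> g) \<le> e * (\<Sum>k<4. measure (\<mu> k) UNIV)"
      by (simp add: sum_distrib_left)
  qed
qed

lemma has_complex_measure_integral_unique: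
  assumes I: "has_complex_measure_integral \<nu> f I" and J: "has_complex_measure_integral \<nu> f J"
    and f: "f \<in> borel_measurable borel" "\<And>s. cmod (f s) \<le> B"
  shows "I = J"
proof (rule ccontr)
  assume "I \<noteq> J"
  obtain K where K: "K \<ge> 0" "\<And>g e. g \<in> borel_measurable borel \<Longrightarrow> finite (range g) \<Longrightarrow>
    (\<And>s. cmod (f s - g s) \<le> e) \<Longrightarrow> cmod (I - simple_sum \<nu> g) \<le> e * K"
    using has_complex_measure_integral_approx[OF I f(1)] by metis
  obtain K' where K': "K' \<ge> 0" "\<And>g e. g \<in> borel_measurable borel \<Longrightarrow> finite (range g) \<Longrightarrow>
    (\<And>s. cmod (f s - g s) \<le> e) \<Longrightarrow> cmod (J - simple_sum \<nu> g) \<le> e * K'"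
    using has_complex_measure_integral_approx[OF J f(1)] by metis
  define e where "e = cmod (I - J) / (K + K' + 1)"
  have e: "e > 0" using \<open>I \<noteq> J\<close> K(1) K'(1) by (simp add: e_def)
  obtain g where g: "g \<in> borel_measurable borel" "finite (range g)" "\<And>s. cmod (f s - g s) \<le> e"
    using uniform_simple_approximation[OF f e] by blast
  have "cmod (I - J) \<le> cmod (I - simple_sum \<nu> g) + cmod (J - simple_sum \<nu> g)"
    by (metis norm_minus_commute norm_triangle_sub dist_norm dist_triangle2)
  also have "\<dots> \<le> e * (K + K')"
    using K(2)[OF g] K'(2)[OF g] by (simp add: algebra_simps)
  also have "\<dots> < e * (K + K' + 1)" using e by simp
  also have "\<dots> = cmod (I - J)" using K(1) K'(1) by (simp add: e_def)
  finally show False by simp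
qed

definition form_measure :: "(real set \<Rightarrow> 'a::complex_hilbert_space \<Rightarrow>\<^sub>L 'a) \<Rightarrow> 'a \<Rightarrow> real measure" where
  "form_measure Q x = measure_of UNIV (sets borel)
      (\<lambda>E. ennreal (Re (cinner (blinfun_apply (Q E) x) x)))"

lemma sets_form_measure [simp]: "sets (form_measure Q x) = sets borel"
  by (simp add: form_measure_def sets.sigma_sets_eq[of borel, simplified])

lemma emeasure_form_measure:
  assumes Q: "operator_measure Q" and E: "E \<in> sets borel"
  shows "emeasure (form_measure Q x) E = ennreal (Re (cinner (blinfun_apply (Q E) x) x))"
proof (rule emeasure_measure_of[OF form_measure_def])
  let ?m = "\<lambda>E. ennreal (Re (cinner (blinfun_apply (Q E) x) x))"
  have additive: "\<And>F :: nat \<Rightarrow> real set. range F \<subseteq> sets borel \<Longrightarrow> disjoint_family F \<Longrightarrow>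
      (\<lambda>n. blinfun_apply (Q (F n)) x) sums blinfun_apply (Q (\<Union>n. F n)) x"
    using Q unfolding operator_measure_def by blast
  have nonneg: "0 \<le> Re (cinner (blinfun_apply (Q E) x) x)" if "E \<in> sets borel" for E
    using Q that by (auto simp: operator_measure_def op_nonneg_def complex_nonneg_Reals_iff)
  show "positive (sets (form_measure Q x)) ?m"
  proof -
    \<comment> \<open>additivity for the constant sequence \<open>{}\<close>: a convergent constant series has zero terms\<close>
    have "(\<lambda>n::nat. blinfun_apply (Q {}) x) sums blinfun_apply (Q {}) x"
      using additive[of "\<lambda>_. {}"] by (simp add: disjoint_family_on_def)
    then have "blinfun_apply (Q {}) x = 0" using sums_summable summable_const_iff by blast
    then show ?thesis by (simp add: positive_def)
  qed
  show "countably_additive (sets (form_measure Q x)) ?m"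
  proof (rule countably_additiveI)
    fix F :: "nat \<Rightarrow> real set"
    assume "range F \<subseteq> sets (form_measure Q x)" and disj: "disjoint_family F"
    then have F: "range F \<subseteq> sets borel" by simp
    have "(\<lambda>n. Re (cinner (blinfun_apply (Q (F n)) x) x)) sums Re
        (cinner (blinfun_apply (Q (\<Union>n. F n)) x) x)"
      by (intro bounded_linear.sums[OF bounded_linear_Re]
          bounded_linear.sums[OF bounded_linear_cinner_left]
          additive F disj)
    then show "(\<Sum>n. ?m (F n)) = ?m (\<Union>n. F n)"
      using F nonneg by (intro suminf_ennreal_eq) auto
  qed
qed (use E in auto)

lemma finite_form_measure:
  assumes "operator_measure Q" shows "finite_measure (form_measure Q x)"
  by (rule finite_measureI)
    (simp add: emeasure_form_measure[OF assms] sets_eq_imp_space_eq[OF sets_form_measure])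

lemma measure_form_measure:
  assumes Q: "operator_measure Q" and E: "E \<in> sets borel"
  shows "complex_of_real (measure (form_measure Q x) E) = cinner (blinfun_apply (Q E) x) x"
proof -
  have "cinner (blinfun_apply (Q E) x) x \<in> \<real>\<^sub>\<ge>\<^sub>0"
    using Q E by (auto simp: operator_measure_def op_nonneg_def)
  then show ?thesis
    by (auto simp: measure_def emeasure_form_measure[OF Q E] complex_nonneg_Reals_iff
        complex_eq_iff)
qed

definition simple_op_integral ::
    "(real set \<Rightarrow> 'a::complex_hilbert_space \<Rightarrow>\<^sub>L 'a) \<Rightarrow> (real \<Rightarrow> complex) \<Rightarrow> ('a \<Rightarrow>\<^sub>L 'a)" where
  "simple_op_integral Q g = (\<Sum>c\<in>range g. scalar_op c o\<^sub>L Q (g -` {c}))"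

lemma simple_op_integral:
  assumes Q: "operator_measure Q" and g: "g \<in> borel_measurable borel" "finite (range g)"
  shows "simple_op_integral Q g \<in> bounded_ops"
    and "cinner (blinfun_apply (simple_op_integral Q g) x) x = (LINT s|form_measure Q x. g s)"
proof -
  have "Q (g -` {c}) \<in> bounded_ops" for c
    using Q vimage_singleton_borel[OF g(1)] by (simp add: operator_measure_def op_nonneg_def)
  then show "simple_op_integral Q g \<in> bounded_ops"
    unfolding simple_op_integral_def by (intro bounded_ops_sum bounded_ops_intros)
  show "cinner (blinfun_apply (simple_op_integral Q g) x) x = (LINT s|form_measure Q x. g s)"
    unfolding integral_eq_simple_sum[OF finite_form_measure[OF Q] sets_form_measure g]
      simple_op_integral_def simple_sum_def
    by (simp add: measure_form_measure[OF Q] vimage_singleton_borel[OF g(1)] blinfun.sum_left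
        cinner_sum_left scalar_op.rep_eq cinner_scaleC_left)
qed

text \<open>
  For simple functions the operator is an explicit finite sum. Uniform approximation of \<open>f\<close> makes
  the quadratic forms of these sums uniformly Cauchy on the unit ball, because the total mass of
  \<open>form_measure Q x\<close> is at most \<open>\<parallel>Q(\<real>)\<parallel> \<parallel>x\<parallel>\<^sup>2\<close>; the numerical radius then makes the sums
  themselves Cauchy in norm.
\<close>

lemma op_integral_exists:
  fixes Q :: "real set \<Rightarrow> 'a::complex_hilbert_space \<Rightarrow>\<^sub>L 'a"
  assumes Q: "operator_measure Q" and f: "f \<in> borel_measurable borel" "\<And>s. cmod (f s) \<le> B"
  obtains T where "T \<in> bounded_ops" "\<And>x. cinner (blinfun_apply T x) x =
      (LINT s|form_measure Q x. f s)"
proof -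
  define K where "K = norm (Q UNIV)"
  define e where "e n = inverse (real (Suc n))" for n
  have e: "e n > 0" for n by (simp add: e_def)
  have e0: "e \<longlonglongrightarrow> 0" unfolding e_def by (rule LIMSEQ_inverse_real_of_nat)
  have fin: "finite_measure (form_measure Q x)" for x by (rule finite_form_measure[OF Q])
  have mass: "measure (form_measure Q x) UNIV \<le> K * (norm x)\<^sup>2" for x
  proof -
    have "measure (form_measure Q x) UNIV = cmod (cinner (blinfun_apply (Q UNIV) x) x)"
      by (simp flip: measure_form_measure[OF Q])
    then show ?thesis using norm_quadratic_form_le[of "Q UNIV" x] by (simp add: K_def)
  qed
  have "\<forall>n. \<exists>g. g \<in> borel_measurable borel \<and> finite (range g) \<and> (\<forall>s. cmod (f s - g s) \<le> e n)"
    using uniform_simple_approximation[OF f e] by blast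
  then obtain g where "\<forall>n. g n \<in> borel_measurable borel \<and> finite (range (g n)) \<and>
      (\<forall>s. cmod (f s - g n s) \<le> e n)"
    by metis
  then have g: "g n \<in> borel_measurable borel" "finite (range (g n))" "cmod (f s - g n s) \<le> e n"
      for n s
    by blast+
  define T where "T n = simple_op_integral Q (g n)" for n
  note T = simple_op_integral[OF Q g(1,2), folded T_def]
  have diff_meas: "(\<lambda>s. f s - g n s) \<in> borel_measurable borel" for n using f(1) g(1) by simp
  have f_int: "integrable (form_measure Q x) f" for x
    using norm_integral_le_measure(1)[OF fin _ f(1), where A = UNIV and e = B] f(2) by simp
  have dist_f: "cmod ((LINT s|form_measure Q x. f s) - cinner (blinfun_apply (T n) x) x) \<le> e n *
      (K * (norm x)\<^sup>2)" for n x
  proof -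
    note b = norm_integral_le_measure[OF fin sets_form_measure[of Q x] diff_meas, where A = UNIV
        and e = "e n", simplified, OF g(3)]
    have "integrable (form_measure Q x) (g n)"
      using Bochner_Integration.integrable_diff[OF f_int b(1)] by simp
    then have "cmod ((LINT s|form_measure Q x. f s) - cinner (blinfun_apply (T n) x) x) \<le> e n *
        measure (form_measure Q x) UNIV"
      using b(2) f_int by (simp add: T(2))
    also have "\<dots> \<le> e n * (K * (norm x)\<^sup>2)"
      by (intro mult_left_mono mass less_imp_le[OF e])
    finally show ?thesis .
  qed
  have gap: "norm (T m - T n) \<le> 2 * ((e m + e n) * K)" for m n
  proof (rule norm_le_numerical_radius)
    fix x
    have "cmod (cinner (blinfun_apply (T m - T n) x) x) \<le>
       cmod ((LINT s|form_measure Q x. f s) - cinner (blinfun_apply (T m) x) x) +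
       cmod ((LINT s|form_measure Q x. f s) - cinner (blinfun_apply (T n) x) x)"
      using norm_triangle_ineq4[of "(LINT s|form_measure Q x. f s) - cinner
          (blinfun_apply (T n) x) x"
          "(LINT s|form_measure Q x. f s) - cinner (blinfun_apply (T m) x) x"]
      by (simp add: blinfun.diff_left cinner_diff_left)
    also have "\<dots> \<le> (e m + e n) * K * (norm x)\<^sup>2"
      using dist_f[of x m] dist_f[of x n] by (simp add: algebra_simps)
    finally show "cmod (cinner (blinfun_apply (T m - T n) x) x) \<le> (e m + e n) * K * (norm x)\<^sup>2" .
  qed (use e in \<open>auto simp: K_def T(1) bounded_ops_diff less_imp_le\<close>)
  have "Cauchy T"
  proof (rule metric_CauchyI)
    fix r :: real assume "r > 0"
    have "(\<lambda>n. 4 * (e n * K)) \<longlonglongrightarrow> 4 * (0 * K)" by (intro tendsto_intros e0)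
    then have "\<forall>\<^sub>F n in sequentially. 4 * (e n * K) < r"
      using \<open>r > 0\<close> by (simp add: order_tendsto_iff)
    then obtain N where N: "\<And>n. n \<ge> N \<Longrightarrow> 4 * (e n * K) < r"
      unfolding eventually_sequentially by blast
    have "dist (T m) (T n) < r" if "m \<ge> N" "n \<ge> N" for m n
      using gap[of m n] N[OF that(1)] N[OF that(2)] by (simp add: dist_norm algebra_simps)
    then show "\<exists>N. \<forall>m\<ge>N. \<forall>n\<ge>N. dist (T m) (T n) < r" by blast
  qed
  then obtain T' where T': "T \<longlonglongrightarrow> T'" using Cauchy_convergent convergent_def by blast
  show thesis
  proof (rule that)
    show "T' \<in> bounded_ops" using bounded_ops_limit[OF T' T(1)] .
    fix x
    show "cinner (blinfun_apply T' x) x = (LINT s|form_measure Q x. f s)"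
    proof (rule LIMSEQ_unique)
      show "(\<lambda>n. cinner (blinfun_apply (T n) x) x) \<longlonglongrightarrow> cinner (blinfun_apply T' x) x"
        by (intro tendsto_cinner_left tendsto_blinfun_apply T')
      have "(\<lambda>n. e n * (K * (norm x)\<^sup>2)) \<longlonglongrightarrow> 0 * (K * (norm x)\<^sup>2)"
        by (intro tendsto_intros e0)
      then have bound_tendsto: "(\<lambda>n. e n * (K * (norm x)\<^sup>2)) \<longlonglongrightarrow> 0" by simp
      have "cmod (cinner (blinfun_apply (T n) x) x - (LINT s|form_measure Q x. f s))
          \<le> e n * (K * (norm x)\<^sup>2)" for n
        by (subst norm_minus_commute) (rule dist_f)
      then have "(\<lambda>n. cinner (blinfun_apply (T n) x) x - (LINT s|form_measure Q x. f s)) \<longlonglongrightarrow> 0"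
        by (rule Lim_null_comparison[OF always_eventually[OF allI] bound_tendsto])
      then show "(\<lambda>n. cinner (blinfun_apply (T n) x) x) \<longlonglongrightarrow> (LINT s|form_measure Q x. f s)"
        by (simp add: LIM_zero_iff)
    qed
  qed
qed

text \<open>
  The integral of a bounded function is determined by its quadratic form, which is a Bochner
  integral against a positive measure. Polarization carries that form to the complex measures
  \<open>\<langle>Q(E)x, y\<rangle>\<close> of the defining property.
\<close>

lemma op_integral:
  fixes Q :: "real set \<Rightarrow> 'a::complex_hilbert_space \<Rightarrow>\<^sub>L 'a"
  assumes Q: "operator_measure Q" and f: "f \<in> borel_measurable borel" "\<And>s. cmod (f s) \<le> B"
  shows "op_integral Q f \<in> bounded_ops"
    and "cinner (blinfun_apply (op_integral Q f) x) x = (LINT s|form_measure Q x. f s)"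
proof -
  obtain T where T: "T \<in> bounded_ops"
      "\<And>x. cinner (blinfun_apply T x) x = (LINT s|form_measure Q x. f s)"
    using op_integral_exists[OF Q f] by blast
  have int: "has_complex_measure_integral (\<lambda>E. cinner (blinfun_apply (Q E) x) y) f
      (cinner (blinfun_apply T x) y)" for x y
    unfolding has_complex_measure_integral_def
  proof (intro exI conjI allI impI ballI)
    let ?v = "\<lambda>k. (1/2) *\<^sub>R (x + (\<i> ^ k) *\<^sub>C y)"
    let ?\<mu> = "\<lambda>k. form_measure Q (?v k)"
    fix k :: nat
    show "finite_measure (?\<mu> k)" by (rule finite_form_measure[OF Q])
    then show "integrable (?\<mu> k) f"
      using norm_integral_le_measure(1)[OF _ sets_form_measure f(1), where A = UNIV and e = B]
          f(2) by simp
    show "sets (?\<mu> k) = sets borel" by simp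
    show "cinner (blinfun_apply T x) y = (\<Sum>k<4. \<i> ^ k * (LINT s|?\<mu> k. f s))"
      unfolding T(2)[symmetric] by (rule polarization[OF T(1), symmetric])
    fix E :: "real set" assume E: "E \<in> sets borel"
    then have "Q E \<in> bounded_ops" using Q by (simp add: operator_measure_def op_nonneg_def)
    then show "cinner (blinfun_apply (Q E) x) y =
        (\<Sum>k<4. \<i> ^ k * complex_of_real (measure (?\<mu> k) E))"
      unfolding measure_form_measure[OF Q E] by (rule polarization[symmetric])
  qed
  have "op_integral Q f = T"
    unfolding op_integral_def
  proof (rule the_equality)
    fix S
    assume S: "S \<in> bounded_ops \<and> (\<forall>x y. has_complex_measure_integral
      (\<lambda>E. cinner (blinfun_apply (Q E) x) y) f (cinner (blinfun_apply S x) y))"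
    show "S = T"
    proof (rule op_eqI_quadratic)
      fix x
      show "cinner (blinfun_apply S x) x = cinner (blinfun_apply T x) x"
        by (rule has_complex_measure_integral_unique[OF _ int f]) (use S in blast)
    qed (use S T in auto)
  qed (use T(1) int in blast)
  with T show "op_integral Q f \<in> bounded_ops"
    "cinner (blinfun_apply (op_integral Q f) x) x = (LINT s|form_measure Q x. f s)" by simp_all
qed

section \<open>The resolvent of a self-adjoint operator\<close>

text \<open>
  The equations \<open>R = I + BR\<close> and \<open>R' = I + R'B\<close> have solutions by the contraction principle, and a
  right inverse and a left inverse coincide.
\<close>

lemma neumann_inverse:
  fixes B :: "'a::banach \<Rightarrow>\<^sub>L 'a"
  assumes "norm B < 1"
  shows "\<exists>R. R o\<^sub>L (id_blinfun - B) = id_blinfun \<and> (id_blinfun - B) o\<^sub>L R = id_blinfun"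
proof -
  have "\<exists>!R. id_blinfun + (B o\<^sub>L R) = R"
    by (rule banach_fix_type[OF norm_ge_zero assms])
      (simp add: dist_norm norm_blinfun_compose flip: compose_simps)
  then obtain R where R: "id_blinfun + (B o\<^sub>L R) = R" by blast
  have "\<exists>!R. id_blinfun + (R o\<^sub>L B) = R"
    by (rule banach_fix_type[OF norm_ge_zero assms])
      (simp add: dist_norm norm_blinfun_compose mult.commute[of "norm B"] flip: compose_simps)
  then obtain R' where R': "id_blinfun + (R' o\<^sub>L B) = R'" by blast
  have 1: "(id_blinfun - B) o\<^sub>L R = id_blinfun"
    using R by (simp add: compose_simps algebra_simps)
  have 2: "R' o\<^sub>L (id_blinfun - B) = id_blinfun"
    using R' by (simp add: compose_simps algebra_simps)
  have "R' = R' o\<^sub>L ((id_blinfun - B) o\<^sub>L R)" by (simp add: 1)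
  also have "\<dots> = R" using 2 by (metis blinfun_compose_assoc blinfun_compose_id(2))
  finally show ?thesis using 1 2 by blast
qed

text \<open>
  A two-sided inverse of a complex-linear map is complex-linear, so it qualifies as \<open>op_inverse\<close>.
\<close>

lemma op_inverse_eq:
  assumes T: "T \<in> bounded_ops" and l: "R o\<^sub>L T = id_blinfun" and r: "T o\<^sub>L R = id_blinfun"
  shows "op_inverse T = R" "R \<in> bounded_ops"
proof -
  have left: "blinfun_apply R (blinfun_apply T x) = x" and right:
      "blinfun_apply T (blinfun_apply R x) = x" for x
    using l r by (metis blinfun_apply_blinfun_compose blinfun_apply_id_blinfun)+
  have "blinfun_apply R (c *\<^sub>C x) = c *\<^sub>C blinfun_apply R x" for c x
    by (metis left right bounded_opsD[OF T])
  then show R: "R \<in> bounded_ops" by (simp add: bounded_ops_def)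
  have "R' = R" if "R' o\<^sub>L T = id_blinfun" for R'
    using that r by (metis blinfun_compose_assoc blinfun_compose_id)
  with R l r show "op_inverse T = R" unfolding op_inverse_def by (intro the_equality) blast+
qed

text \<open>
  The cross term vanishes because \<open>\<langle>(Y - Re w)x, x\<rangle>\<close> is real.
\<close>

lemma norm_selfadjoint_minus_scalar:
  assumes Y: "op_selfadjoint Y"
  shows "(norm (blinfun_apply Y x - w *\<^sub>C x))\<^sup>2
    = (norm (blinfun_apply Y x - Re w *\<^sub>R x))\<^sup>2 + (Im w)\<^sup>2 * (norm x)\<^sup>2"
proof -
  define u where "u = blinfun_apply Y x - Re w *\<^sub>R x"
  have "cinner u x = cinner x u"
    using Y by (simp add: u_def cinner_simps op_selfadjoint_def)
  then have "Im (cinner u x) = 0" "Im (cinner x u) = 0"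
    by (metis cinner_commute cnj.sel(2) equal_neg_zero)+
  moreover have "blinfun_apply Y x - w *\<^sub>C x = u - (\<i> * Im w) *\<^sub>C x"
    by (subst complex_eq[of w]) (simp add: u_def scaleC_add_left scaleR_scaleC)
  ultimately show ?thesis
    unfolding u_def[symmetric] norm_sq_eq_Re_cinner
    by (simp add: cinner_simps power2_eq_square)
qed

text \<open>
  Seen from a point \<open>w = -\<i> t\<close> far below the real axis, \<open>z\<close> is farther away than the spectrum of
  \<open>Y\<close>: \<open>\<parallel>Y - w\<parallel>\<^sup>2 \<le> \<parallel>Y\<parallel>\<^sup>2 + t\<^sup>2\<close>, whereas \<open>\<bar>w - z\<bar>\<^sup>2\<close> grows like \<open>t\<^sup>2 + 2 t Im z\<close>. Hence \<open>Y - z =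
  (w - z)(I - (w - z)\<inverse>(w - Y))\<close> is invertible by a Neumann series.
\<close>

lemma resolvent_right_inverse:
  fixes Y :: "'a::complex_hilbert_space \<Rightarrow>\<^sub>L 'a"
  assumes Y: "op_selfadjoint Y" and z: "Im z > 0"
  shows "op_inverse (Y - scalar_op z) \<in> bounded_ops"
    and "blinfun_apply (Y - scalar_op z) (blinfun_apply (op_inverse (Y - scalar_op z)) x) = x"
proof -
  \<comment> \<open>large enough for \<open>2 t Im z > \<parallel>Y\<parallel>\<^sup>2\<close>\<close>
  define t where "t = ((norm Y)\<^sup>2 + 1) / Im z"
  define w where "w = Complex 0 (- t)"
  define B where "B = scalar_op (inverse (w - z)) o\<^sub>L (scalar_op w - Y)"
  have t: "t > 0" "t * Im z = (norm Y)\<^sup>2 + 1"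
    using z by (auto simp: t_def intro!: divide_pos_pos add_nonneg_pos)
  have Yops: "Y \<in> bounded_ops" using Y by (simp add: op_selfadjoint_def)
  have "(norm Y)\<^sup>2 + t\<^sup>2 < (cmod (w - z))\<^sup>2"
  proof -
    have "(cmod (w - z))\<^sup>2 = (Re z)\<^sup>2 + (Im z)\<^sup>2 + t\<^sup>2 + 2 * (t * Im z)"
      unfolding cmod_power2 by (simp add: w_def power2_eq_square algebra_simps)
    then show ?thesis using t(2) z by (simp add: add_pos_pos add_nonneg_pos)
  qed
  then have gap: "sqrt ((norm Y)\<^sup>2 + t\<^sup>2) < cmod (w - z)"
    by (rule real_less_lsqrt[rotated]) auto
  then have wz: "cmod (w - z) > 0" by (meson le_less_trans real_sqrt_ge_zero sum_power2_ge_zero)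
  have "norm B \<le> sqrt ((norm Y)\<^sup>2 + t\<^sup>2) / cmod (w - z)"
  proof (rule norm_blinfun_bound)
    fix x
    have "(norm (w *\<^sub>C x - blinfun_apply Y x))\<^sup>2 = (norm (blinfun_apply Y x))\<^sup>2 + t\<^sup>2 * (norm x)\<^sup>2"
      using norm_selfadjoint_minus_scalar[OF Y, of x w] by (simp add: norm_minus_commute w_def)
    also have "\<dots> \<le> ((norm Y)\<^sup>2 + t\<^sup>2) * (norm x)\<^sup>2"
      using power_mono[OF norm_blinfun[of Y x] norm_ge_zero, of 2]
      by (simp add: power_mult_distrib algebra_simps)
    finally have "(norm (w *\<^sub>C x - blinfun_apply Y x))\<^sup>2 \<le> (sqrt ((norm Y)\<^sup>2 + t\<^sup>2) * norm x)\<^sup>2"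
      by (simp add: power_mult_distrib)
    then have "norm (w *\<^sub>C x - blinfun_apply Y x) \<le> sqrt ((norm Y)\<^sup>2 + t\<^sup>2) * norm x"
      by (rule power2_le_imp_le) simp
    then have "norm (w *\<^sub>C x - blinfun_apply Y x) / cmod (w - z)
        \<le> sqrt ((norm Y)\<^sup>2 + t\<^sup>2) * norm x / cmod (w - z)"
      by (rule divide_right_mono) simp
    moreover have "norm (blinfun_apply B x) = norm (w *\<^sub>C x - blinfun_apply Y x) / cmod (w - z)"
      by (simp only: B_def blinfun_apply_blinfun_compose blinfun.diff_left scalar_op.rep_eq
          norm_scaleC norm_inverse divide_inverse mult.commute)
    ultimately show "norm (blinfun_apply B x) \<le> sqrt ((norm Y)\<^sup>2 + t\<^sup>2) / cmod (w - z) * norm x"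
      by simp
  qed simp
  also have "\<dots> < 1" using gap wz by simp
  finally obtain R where R: "R o\<^sub>L (id_blinfun - B) = id_blinfun"
      "(id_blinfun - B) o\<^sub>L R = id_blinfun"
    using neumann_inverse by blast
  have nz: "w - z \<noteq> 0" using wz by auto
  have inv: "scalar_op (w - z) o\<^sub>L scalar_op (inverse (w - z)) = (id_blinfun :: 'a \<Rightarrow>\<^sub>L 'a)"
    "scalar_op (inverse (w - z)) o\<^sub>L scalar_op (w - z) = (id_blinfun :: 'a \<Rightarrow>\<^sub>L 'a)"
    by (rule blinfun_eqI, simp only: blinfun_apply_blinfun_compose scalar_op.rep_eq scaleC_scaleC
        right_inverse[OF nz] left_inverse[OF nz] scaleC_one blinfun_apply_id_blinfun)+
  have "scalar_op (w - z) o\<^sub>L B = scalar_op w - Y"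
    unfolding B_def by (simp only: inv blinfun_compose_id flip: blinfun_compose_assoc)
  moreover have "scalar_op (w - z) = scalar_op w - (scalar_op z :: 'a \<Rightarrow>\<^sub>L 'a)"
    by (rule blinfun_eqI) (simp add: scalar_op.rep_eq blinfun.diff_left scaleC_diff_left)
  ultimately have fac: "Y - scalar_op z = scalar_op (w - z) o\<^sub>L (id_blinfun - B)"
    by (simp add: compose_simps)
  define R' where "R' = R o\<^sub>L scalar_op (inverse (w - z))"
  have left: "R' o\<^sub>L (Y - scalar_op z) = id_blinfun"
    unfolding R'_def fac by (metis R(1) inv(2) blinfun_compose_assoc blinfun_compose_id(2))
  have right: "(Y - scalar_op z) o\<^sub>L R' = id_blinfun"
    unfolding R'_def fac by (metis R(2) inv(1) blinfun_compose_assoc blinfun_compose_id(2))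
  note R' = op_inverse_eq[OF bounded_ops_diff[OF Yops bounded_ops_scalar] left right]
  show "op_inverse (Y - scalar_op z) \<in> bounded_ops" using R' by simp
  show "blinfun_apply (Y - scalar_op z) (blinfun_apply (op_inverse (Y - scalar_op z)) x) = x"
    unfolding R'(1) using right by (metis blinfun_apply_blinfun_compose blinfun_apply_id_blinfun)
qed

lemma op_le_scalar_form:
  shows "op_le (scalar_op (complex_of_real a)) Y \<Longrightarrow> a * (norm x)\<^sup>2 \<le> Re
      (cinner (blinfun_apply Y x) x)"
    and "op_le Y (scalar_op (complex_of_real b)) \<Longrightarrow> Re (cinner (blinfun_apply Y x) x) \<le> b *
        (norm x)\<^sup>2"
proof -
  assume "op_le (scalar_op (complex_of_real a)) Y"
  then have "cinner (blinfun_apply (Y - scalar_op (complex_of_real a)) x) x \<in> \<real>\<^sub>\<ge>\<^sub>0"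
    by (simp add: op_le_def op_nonneg_def)
  then show "a * (norm x)\<^sup>2 \<le> Re (cinner (blinfun_apply Y x) x)"
    by (simp add: complex_nonneg_Reals_iff blinfun.diff_left scalar_op.rep_eq cinner_simps
        norm_sq_eq_Re_cinner)
next
  assume "op_le Y (scalar_op (complex_of_real b))"
  then have "cinner (blinfun_apply (scalar_op (complex_of_real b) - Y) x) x \<in> \<real>\<^sub>\<ge>\<^sub>0"
    by (simp add: op_le_def op_nonneg_def)
  then show "Re (cinner (blinfun_apply Y x) x) \<le> b * (norm x)\<^sup>2"
    by (simp add: complex_nonneg_Reals_iff blinfun.diff_left scalar_op.rep_eq cinner_simps
        norm_sq_eq_Re_cinner)
qed

text \<open>
  The bound of the resolvent by the inverse distance to \<open>[a, b]\<close>, in elementary form: the real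
  part \<open>Re z\<close> has distance \<open>\<rho>\<close> from \<open>[a, b]\<close>, the form bounds give \<open>\<parallel>(Y - Re z)x\<parallel> \<ge> \<rho> \<parallel>x\<parallel>\<close>, and
  \<open>\<rho>\<^sup>2 + (Im z)\<^sup>2\<close> is the squared distance of \<open>z\<close> from \<open>[a, b]\<close>.
\<close>

lemma norm_minus_scalar_ge:
  fixes Y :: "'a::complex_hilbert_space \<Rightarrow>\<^sub>L 'a"
  assumes Y: "op_selfadjoint Y"
    and lower: "\<And>x. a * (norm x)\<^sup>2 \<le> Re (cinner (blinfun_apply Y x) x)"
    and upper: "\<And>x. Re (cinner (blinfun_apply Y x) x) \<le> b * (norm x)\<^sup>2"
    and ab: "a \<le> b" and L: "L > 0" and dist: "\<And>s. s \<in> {a..b} \<Longrightarrow> L \<le> cmod (z - complex_of_real s)"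
  shows "L * norm x \<le> norm (blinfun_apply Y x - z *\<^sub>C x)"
proof -
  define \<rho> where "\<rho> = max 0 (max (a - Re z) (Re z - b))"
  have \<rho>0: "\<rho> \<ge> 0" by (simp add: \<rho>_def)
  \<comment> \<open>the point of \<open>[a, b]\<close> nearest to \<open>z\<close>\<close>
  define s where "s = max a (min b (Re z))"
  have "s \<in> {a..b}" using ab by (auto simp: s_def)
  have "\<bar>Re z - s\<bar> = \<rho>" using ab by (auto simp: s_def \<rho>_def max_def min_def)
  then have "(Re z - s)\<^sup>2 = \<rho>\<^sup>2" by (metis power2_abs)
  then have L2: "L\<^sup>2 \<le> \<rho>\<^sup>2 + (Im z)\<^sup>2"
    using power_mono[OF dist[OF \<open>s \<in> {a..b}\<close>], of 2] L by (simp add: cmod_power2)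
  define u where "u = blinfun_apply Y x - Re z *\<^sub>R x"
  have form: "Re (cinner u x) = Re (cinner (blinfun_apply Y x) x) - Re z * (norm x)\<^sup>2"
    by (simp add: u_def cinner_simps cinner_self)
  have "\<rho> * (norm x)\<^sup>2 \<le> \<bar>Re (cinner u x)\<bar>"
  proof -
    have "(a - Re z) * (norm x)\<^sup>2 \<le> \<bar>Re (cinner u x)\<bar>" "(Re z - b) * (norm x)\<^sup>2 \<le> \<bar>Re (cinner u x)\<bar>"
      using lower[of x] upper[of x] unfolding form by (simp_all add: left_diff_distrib)
    then show ?thesis by (simp add: \<rho>_def max_def)
  qed
  also have "\<dots> \<le> norm u * norm x"
    using abs_Re_le_cmod cinner_Cauchy_Schwarz order_trans by blast
  finally have "\<rho> * norm x \<le> norm u"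
    by (cases "x = 0") (simp_all add: power2_eq_square)
  then have "(\<rho> * norm x)\<^sup>2 \<le> (norm u)\<^sup>2" using \<rho>0 by (intro power_mono) auto
  moreover have "L\<^sup>2 * (norm x)\<^sup>2 \<le> (\<rho>\<^sup>2 + (Im z)\<^sup>2) * (norm x)\<^sup>2"
    using L2 by (rule mult_right_mono) simp
  ultimately have "(L * norm x)\<^sup>2 \<le> (norm (blinfun_apply Y x - z *\<^sub>C x))\<^sup>2"
    unfolding norm_selfadjoint_minus_scalar[OF Y] u_def[symmetric]
    by (simp add: power_mult_distrib algebra_simps)
  then show ?thesis by (rule power2_le_imp_le) simp
qed

section \<open>Comparison of the two functions\<close>

text \<open>
  With \<open>v = (Z + d)\<inverse>u\<close> and \<open>\<alpha> = 1/d\<close> this is the second-order expansion of the resolvent, \<open>(Z +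
  d)\<inverse> = \<alpha> - \<alpha>\<^sup>2 Z + \<alpha>\<^sup>2 Z\<^sup>2 (Z + d)\<inverse>\<close>, applied to \<open>u\<close>.
\<close>

lemma resolvent_expansion:
  fixes Z :: "'a::complex_hilbert_space \<Rightarrow>\<^sub>L 'a"
  assumes Z: "Z \<in> bounded_ops" and u: "u = blinfun_apply Z v + d *\<^sub>C v" and \<alpha>: "\<alpha> * d = 1"
  shows "v = \<alpha> *\<^sub>C u - \<alpha>\<^sup>2 *\<^sub>C blinfun_apply Z u + \<alpha>\<^sup>2 *\<^sub>C blinfun_apply Z (blinfun_apply Z v)"
proof -
  have "\<alpha>\<^sup>2 * d = \<alpha>" using \<alpha> by (simp add: power2_eq_square mult.assoc)
  then show ?thesis unfolding u
    by (simp add: blinfun.bilinear_simps bounded_opsD[OF Z] scaleC_add_right scaleC_scaleC \<alpha>)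
qed

text \<open>
  Both resolvents are expanded at the midpoint \<open>c\<close> of \<open>[a, b]\<close>. With \<open>r = (b - a)/2\<close> each
  remainder has a quadratic form bounded by \<open>r\<^sup>2/L\<^sup>3 \<parallel>X\<parallel> \<parallel>x\<parallel>\<^sup>2\<close>. The two remainders and the factor
  2 of the numerical radius give \<open>4 r\<^sup>2 = (b - a)\<^sup>2\<close>.
\<close>

lemma norm_m_fun_minus_m_tilde_le:
  fixes Q :: "real set \<Rightarrow> 'a::complex_hilbert_space \<Rightarrow>\<^sub>L 'a"
  assumes Q: "operator_measure Q" and ab: "a \<le> b" and L: "L > 0"
    and Y: "op_selfadjoint Y" and X: "X = Q {a..b}"
    and XYX: "op_sqrt X o\<^sub>L Y o\<^sub>L op_sqrt X = op_set_integral Q {a..b} (\<lambda>s. complex_of_real s)"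
    and aY: "op_le (scalar_op (complex_of_real a)) Y" and Yb:
        "op_le Y (scalar_op (complex_of_real b))"
    and z: "Im z > 0" and dist: "\<And>s. s \<in> {a..b} \<Longrightarrow> L \<le> cmod (z - complex_of_real s)"
  shows "norm (m_fun Q z - m_tilde Q a b X Y z) \<le> (b - a)\<^sup>2 / L ^ 3 * norm (Q {a..b})"
proof -
  define c r \<alpha> where "c = (a + b) / 2" and "r = (b - a) / 2" and "\<alpha> = 1 / (complex_of_real c - z)"
  define S R Z where "S = op_sqrt X" and "R = op_inverse (Y - scalar_op z)"
    and "Z = Y - scalar_op (complex_of_real c)"
  define f where "f s = 1 / (complex_of_real s - z)" for s :: real
  define outer where "outer s = indicator (- {a..b}) s *\<^sub>R f s" for s
  define inner where "inner s = indicator {a..b} s *\<^sub>R complex_of_real s" for s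
  define w where "w = r\<^sup>2 / L ^ 3"
  have r: "r \<ge> 0" and c: "c \<in> {a..b}" using ab by (auto simp: r_def c_def field_simps)
  have cz: "complex_of_real s - z \<noteq> 0" for s using z by (auto simp: complex_eq_iff)
  have \<alpha>: "\<alpha> * (complex_of_real c - z) = 1" using cz by (simp add: \<alpha>_def)
  have near: "cmod (1 / (complex_of_real s - z)) \<le> 1 / L" if "s \<in> {a..b}" for s
    using dist[OF that] L by (simp add: norm_divide norm_minus_commute frac_le)
  have \<alpha>L: "cmod (\<alpha>\<^sup>2) \<le> 1 / L\<^sup>2"
    using power_mono[OF near[OF c], of 2] by (simp add: \<alpha>_def norm_power power_divide norm_divide)
  have Yops: "Y \<in> bounded_ops" using Y by (simp add: op_selfadjoint_def)
  have Z: "op_selfadjoint Z" and Zops: "Z \<in> bounded_ops"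
    using Y by (simp_all add: Z_def op_selfadjoint_def bounded_ops_intros blinfun.bilinear_simps
        scalar_op.rep_eq cinner_simps)
  have normZ: "norm Z \<le> r"
  proof (rule norm_selfadjoint_le[OF Z _ r])
    fix x
    have "Re (cinner (blinfun_apply Z x) x) = Re (cinner (blinfun_apply Y x) x) - c * (norm x)\<^sup>2"
      by (simp add: Z_def blinfun.diff_left scalar_op.rep_eq cinner_simps cinner_self)
    then show "\<bar>Re (cinner (blinfun_apply Z x) x)\<bar> \<le> r * (norm x)\<^sup>2"
      using op_le_scalar_form(1)[OF aY, of x] op_le_scalar_form(2)[OF Yb, of x]
      by (simp add: c_def r_def abs_le_iff field_simps)
  qed
  have Xnn: "op_nonneg X" using Q X by (simp add: operator_measure_def)
  note S = op_sqrt[OF Xnn, folded S_def]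
  have Sadj: "cinner (blinfun_apply S x) y = cinner x (blinfun_apply S y)" and Sops:
      "S \<in> bounded_ops" for x y
    using S(1) by (simp_all add: op_nonneg_iff op_selfadjoint_def)
  have Rright: "blinfun_apply Y (blinfun_apply R x) - z *\<^sub>C blinfun_apply R x = x" for x
    using resolvent_right_inverse(2)[OF Y z, of x] by
        (simp add: R_def blinfun.diff_left scalar_op.rep_eq)
  have Rnorm: "norm (blinfun_apply R x) \<le> norm x / L" for x
    using norm_minus_scalar_ge[OF Y op_le_scalar_form(1)[OF aY] op_le_scalar_form(2)[OF Yb] ab L
        dist,
        of "blinfun_apply R x"] L by (simp add: Rright field_simps)

  have f_meas: "f \<in> borel_measurable borel" unfolding f_def by measurable
  have f_bound: "cmod (f s) \<le> 1 / Im z" for s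
    using abs_Im_le_cmod[of "complex_of_real s - z"] z
    by (simp add: f_def norm_divide frac_le)
  have outer_meas: "outer \<in> borel_measurable borel"
    unfolding outer_def using f_meas by measurable
  have outer_bound: "cmod (outer s) \<le> 1 / Im z" for s
    using f_bound[of s] z by (auto simp: outer_def indicator_def)
  have inner_meas: "inner \<in> borel_measurable borel" unfolding inner_def by measurable
  have inner_bound: "cmod (inner s) \<le> \<bar>a\<bar> + \<bar>b\<bar>" for s by (auto simp: inner_def indicator_def)
  note f_int = op_integral[OF Q f_meas f_bound]
  note outer_int = op_integral[OF Q outer_meas outer_bound]
  note inner_int = op_integral[OF Q inner_meas inner_bound]

  define D where "D = m_fun Q z - m_tilde Q a b X Y z"
  have D: "D = op_integral Q f - (op_integral Q outer + (S o\<^sub>L R o\<^sub>L S))"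
    by (simp add: D_def m_fun_def m_tilde_def op_set_integral_def f_def[abs_def]
        outer_def[abs_def] S_def R_def)
  have SYS: "S o\<^sub>L Y o\<^sub>L S = op_integral Q inner"
    using XYX by (simp add: S_def op_set_integral_def inner_def[abs_def])
  have "norm D \<le> 2 * (2 * w * norm X)"
  proof (rule norm_le_numerical_radius)
    have "R \<in> bounded_ops"
      unfolding R_def by (rule resolvent_right_inverse(1)[OF Y z])
    then show "D \<in> bounded_ops"
      unfolding D by (intro bounded_ops_intros f_int outer_int Sops)
    show "0 \<le> 2 * w * norm X" using L by (simp add: w_def)
    fix x
    define u v \<mu> where "u = blinfun_apply S x" and "v = blinfun_apply R u" and
        "\<mu> = form_measure Q x"
    have fin: "finite_measure \<mu>" and sets: "sets \<mu> = sets borel"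
      using finite_form_measure[OF Q] by (simp_all add: \<mu>_def)
    \<comment> \<open>with \<open>u = S x\<close>, the moments of order 0 and 1 of \<open>\<mu>\<close> on \<open>[a, b]\<close> are the forms of \<open>I\<close> and
        \<open>Y\<close> at \<open>u\<close>\<close>
    have mass: "complex_of_real (measure \<mu> {a..b}) = cinner u u"
    proof -
      have "cinner (blinfun_apply X x) x = cinner u u"
        using Sadj[of u x] by (simp add: u_def flip: S(2))
      then show ?thesis by (simp add: \<mu>_def measure_form_measure[OF Q] X)
    qed
    then have mass': "measure \<mu> {a..b} = (norm u)\<^sup>2"
      unfolding cinner_self of_real_eq_iff .
    have Yform: "cinner (blinfun_apply Y u) u = (LINT s|\<mu>. inner s)"
    proof -
      have "cinner (blinfun_apply (S o\<^sub>L Y o\<^sub>L S) x) x = cinner (blinfun_apply Y u) u"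
        by (simp add: u_def Sadj)
      then show ?thesis unfolding SYS inner_int(2) \<mu>_def by simp
    qed
    \<comment> \<open>the remainder of \<open>1/(s - z)\<close> after the two terms of its expansion at \<open>c\<close>, cut off to
        \<open>[a, b]\<close>\<close>
    define h where "h s = indicator {a..b} s *\<^sub>R (\<alpha>\<^sup>2 * (complex_of_real (s - c))\<^sup>2 * f s)" for s
    have h_meas: "h \<in> borel_measurable borel" unfolding h_def using f_meas by measurable
    have h_bound: "cmod (h s) \<le> w * indicator {a..b} s" for s
    proof (cases "s \<in> {a..b}")
      case True
      then have "\<bar>s - c\<bar> \<le> r" by (auto simp: c_def r_def abs_le_iff field_simps)
      then have "(s - c)\<^sup>2 \<le> r\<^sup>2" using power_mono[of "\<bar>s - c\<bar>" r 2] by simp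
      then have "cmod (\<alpha>\<^sup>2) * (s - c)\<^sup>2 * cmod (f s) \<le> 1 / L\<^sup>2 * r\<^sup>2 * (1 / L)"
        using near[OF True] \<alpha>L L by (intro mult_mono) (auto simp: f_def)
      also have "\<dots> = w" using L by (simp add: w_def power2_eq_square power3_eq_cube)
      finally show ?thesis using True by (simp add: h_def norm_mult norm_power flip: of_real_diff)
    qed (simp add: h_def)
    have h_eq: "h s = f s - outer s - \<alpha> * indicator {a..b} s + \<alpha>\<^sup>2 *
        (inner s - complex_of_real c * indicator {a..b} s)" for s
    proof (cases "s \<in> {a..b}")
      case True
      define q t where "q = f s" and "t = complex_of_real (s - c)"
      have "(t + (complex_of_real c - z)) * q = 1" using cz[of s] by (simp add: q_def t_def f_def)
      with \<alpha> have "q = \<alpha> - \<alpha>\<^sup>2 * t + \<alpha>\<^sup>2 * t\<^sup>2 * q" by algebra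
      then have "\<alpha>\<^sup>2 * t\<^sup>2 * q = q - \<alpha> + \<alpha>\<^sup>2 * t" by (simp add: algebra_simps)
      with True show ?thesis by (simp add: h_def outer_def inner_def q_def t_def)
    qed (simp add: h_def outer_def inner_def)
    have ind: "integrable \<mu> (\<lambda>s. indicator {a..b} s :: complex)"
      "(LINT s|\<mu>. indicator {a..b} s) = cinner u u"
    proof -
      have ab_sets: "{a..b} \<in> sets \<mu>" "emeasure \<mu> {a..b} < \<infinity>"
        using finite_measure.emeasure_finite[OF fin] by (simp_all add: sets less_top)
      have eq: "(\<lambda>s. indicator {a..b} s :: complex) = (\<lambda>s. indicator {a..b} s *\<^sub>R 1)"
        by (auto simp: indicator_def)
      show "integrable \<mu> (\<lambda>s. indicator {a..b} s :: complex)"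
        unfolding eq using ab_sets by (intro integrable_scaleR_left integrable_real_indicator)
      show "(LINT s|\<mu>. indicator {a..b} s) = cinner u u"
        unfolding eq using ab_sets sets_eq_imp_space_eq[OF sets]
        by (subst integral_scaleR_left) (auto simp: scaleR_conv_of_real mass)
    qed
    have fi: "integrable \<mu> f" "integrable \<mu> outer" "integrable \<mu> inner"
      using norm_integral_le_measure(1)[OF fin sets f_meas, where A = UNIV and e = "1 / Im z"]
        norm_integral_le_measure(1)[OF fin sets outer_meas, where A = UNIV and e = "1 / Im z"]
        norm_integral_le_measure(1)[OF fin sets inner_meas, where A = UNIV and e = "\<bar>a\<bar> + \<bar>b\<bar>"]
        f_bound outer_bound inner_bound by simp_all
    have h_int: "(LINT s|\<mu>. h s) = (LINT s|\<mu>. f s) - (LINT s|\<mu>. outer s) - \<alpha> * cinner u u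
        + \<alpha>\<^sup>2 * cinner (blinfun_apply Z u) u"
    proof -
      have "(LINT s|\<mu>. h s) = (LINT s|\<mu>. f s) - (LINT s|\<mu>. outer s) - \<alpha> * cinner u u
        + \<alpha>\<^sup>2 * (cinner (blinfun_apply Y u) u - complex_of_real c * cinner u u)"
        unfolding h_eq Yform using fi ind by simp
      then show ?thesis by (simp add: Z_def blinfun.diff_left scalar_op.rep_eq cinner_simps)
    qed
    have "u = blinfun_apply Z v + (complex_of_real c - z) *\<^sub>C v"
      using Rright[of u] by (simp add: v_def[symmetric] Z_def blinfun.diff_left scalar_op.rep_eq
          scaleC_diff_left)
    from resolvent_expansion[OF Zops this \<alpha>]
    have "cinner v u = cinner (\<alpha> *\<^sub>C u - \<alpha>\<^sup>2 *\<^sub>C blinfun_apply Z u + \<alpha>\<^sup>2 *\<^sub>C blinfun_apply Z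
        (blinfun_apply Z v)) u"
      by (rule arg_cong)
    then have v_form: "cinner v u = \<alpha> * cinner u u - \<alpha>\<^sup>2 * cinner (blinfun_apply Z u) u
        + \<alpha>\<^sup>2 * cinner (blinfun_apply Z (blinfun_apply Z v)) u"
      by (simp only: cinner_simps)
    have "cinner (blinfun_apply D x) x = (LINT s|\<mu>. f s) - (LINT s|\<mu>. outer s) - cinner v u"
      unfolding D by (simp add: blinfun.bilinear_simps cinner_simps f_int(2) outer_int(2) \<mu>_def
          Sadj u_def v_def)
    \<comment> \<open>the terms of order 0 and 1 cancel, only the two remainders survive\<close>
    then have D_form: "cinner (blinfun_apply D x) x
        = (LINT s|\<mu>. h s) - \<alpha>\<^sup>2 * cinner (blinfun_apply Z (blinfun_apply Z v)) u"
      by (simp add: h_int v_form algebra_simps)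
    have "cmod (cinner (blinfun_apply Z (blinfun_apply Z v)) u) \<le> norm
        (blinfun_apply Z (blinfun_apply Z v)) * norm u"
      by (rule cinner_Cauchy_Schwarz)
    also have "\<dots> \<le> (r * (r * (norm u / L))) * norm u"
    proof (rule mult_right_mono)
      have Zr: "norm (blinfun_apply Z y) \<le> r * norm y" for y
        using norm_blinfun[of Z y] mult_right_mono[OF normZ norm_ge_zero[of y]] by linarith
      have "norm (blinfun_apply Z (blinfun_apply Z v)) \<le> r * (r * norm v)"
        using Zr[of "blinfun_apply Z v"] mult_left_mono[OF Zr[of v] r] by linarith
      also have "\<dots> \<le> r * (r * (norm u / L))"
        unfolding v_def using Rnorm r by (intro mult_left_mono) auto
      finally show "norm (blinfun_apply Z (blinfun_apply Z v)) \<le> r * (r * (norm u / L))" .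
    qed simp
    finally have "cmod (\<alpha>\<^sup>2 * cinner (blinfun_apply Z (blinfun_apply Z v)) u) \<le> 1 / L\<^sup>2 *
        ((r * (r * (norm u / L))) * norm u)"
      unfolding norm_mult using \<alpha>L by (intro mult_mono) auto
    also have "\<dots> = w * (norm u)\<^sup>2"
      by (simp add: w_def power2_eq_square power3_eq_cube)
    finally have "cmod (cinner (blinfun_apply D x) x) \<le> w * (norm u)\<^sup>2 + w * (norm u)\<^sup>2"
      unfolding D_form
      using norm_integral_le_measure(2)[OF fin sets h_meas _ h_bound] mass'
      by (intro norm_triangle_le_diff add_mono) auto
    also have "\<dots> = 2 * w * (norm u)\<^sup>2" by simp
    also have "\<dots> \<le> 2 * w * (norm X * (norm x)\<^sup>2)"
    proof (rule mult_left_mono)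
      have "(norm u)\<^sup>2 = cmod (cinner (blinfun_apply X x) x)"
        unfolding X by (simp flip: measure_form_measure[OF Q] mass' add: \<mu>_def)
      then show "(norm u)\<^sup>2 \<le> norm X * (norm x)\<^sup>2" by (simp add: norm_quadratic_form_le)
    qed (use L in \<open>simp add: w_def\<close>)
    finally show "cmod (cinner (blinfun_apply D x) x) \<le> 2 * w * norm X * (norm x)\<^sup>2" by simp
  qed
  also have "2 * (2 * w * norm X) = (b - a)\<^sup>2 / L ^ 3 * norm (Q {a..b})"
    by (simp add: w_def r_def X power_divide)
  finally show ?thesis unfolding D_def .
qed

theorem theorem26:
  fixes Q :: "real set \<Rightarrow> 'a::complex_hilbert_space \<Rightarrow>\<^sub>L 'a"
    and X Y :: "'a \<Rightarrow>\<^sub>L 'a"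
    and a b L :: real
  assumes "operator_measure Q"
    and "a \<le> b"
    and "L > 0"
    and "op_selfadjoint X"
    and "op_selfadjoint Y"
    and "X = op_set_integral Q {a..b} (\<lambda>s. 1)"
    and "X = Q {a..b}"
    and "op_sqrt X o\<^sub>L Y o\<^sub>L op_sqrt X = op_set_integral Q {a..b} (\<lambda>s. complex_of_real s)"
    and "op_le (scalar_op (complex_of_real a)) Y"
    and "op_le Y (scalar_op (complex_of_real b))"
  shows "\<forall>z. Im z > 0 \<longrightarrow> infdist z (complex_of_real ` {a..b}) \<ge> L \<longrightarrow>
    norm (m_fun Q z - m_tilde Q a b X Y z) \<le> 2 * (b - a)\<^sup>2 / L ^ 3 * norm (Q {a..b})"
proof (intro allI impI)
  fix z
  assume z: "Im z > 0" and inf: "infdist z (complex_of_real ` {a..b}) \<ge> L"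
  have dist: "L \<le> cmod (z - complex_of_real s)" if "s \<in> {a..b}" for s
    using infdist_le[of "complex_of_real s" "complex_of_real ` {a..b}" z] inf that
    by (simp add: dist_norm)
  have "norm (m_fun Q z - m_tilde Q a b X Y z) \<le> (b - a)\<^sup>2 / L ^ 3 * norm (Q {a..b})"
    using assms(1-3,5,7-10) z dist by (rule norm_m_fun_minus_m_tilde_le)
  also have "\<dots> \<le> 2 * (b - a)\<^sup>2 / L ^ 3 * norm (Q {a..b})"
    using assms(3) by (intro mult_right_mono divide_right_mono) auto
  finally show "norm (m_fun Q z - m_tilde Q a b X Y z) \<le> 2 * (b - a)\<^sup>2 / L ^ 3 * norm (Q {a..b})" .
qed

end
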